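(* Let $n\ge 1$, let $U,V\subset\mathbb{R}^n$ be $0$-symmetric closed convex bodies, and put $H:=\tfrac12U$. Let $\Lambda\subset\mathbb{R}^n$ be a lattice of rank $n$ such that $H+\Lambda$ is a lattice packing of $H$. Then $$C_n(U,V)\ge\frac{|\Lambda\cap \operatorname{int}V|\,|U|}{|V|}.$$ In particular, $$C_n(U,V)\ge 2^n\delta_L(H)(1+o(1))\quad\text{as } |V|\to\infty,$$ that is, for fixed $n$ and $U$ and every $\varepsilon>0$ there is $T>0$ such that $C_n(U,V)\ge 2^n\delta_L(H)(1-\varepsilon)$ for every $0$-symmetric closed convex body $V\subset\mathbb{R}^n$ with $|V|\ge T$.
   Context: A convex body is a compact convex set with nonempty interior; it is $0$-symmetric if $A=-A$. $\operatorname{int}A$ is the interior of $A$, $A+B$ denotes the Minkowski sum and $\lambda A=\{\lambda a: a\in A\}$. $|A|$ denotes the volume (Lebesgue measure) of $A$, or the cardinality of $A$ if $A$ is a finite set. A continuous function $f:\mathbb{R}^n\to\mathbb{C}$ is positive definite if for every finite $Y\subset\mathbb{R}^n$ and all complex numbers $\{c_a: a\in Y\}$ one has $\sum_{a,b\in Y}c_a\overline{c_b}f(a-b)\ge 0$. A double positive definite function, written $f\succeq 0$, is a continuous positive definite function $f$ on $\mathbb{R}^n$ with values in $\mathbb{R}_+=[0,\infty)$. For $0$-symmetric closed convex bodies $U,V\subset\mathbb{R}^n$, $$C_n(U,V):=\sup_{f\succeq 0,\ f\ne 0}\frac{\frac{1}{|V|}\int_V f(x)\,dx}{\frac{1}{|U|}\int_U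 f(x)\,dx}.$$ A lattice of rank $n$ is a set $\Lambda=M\mathbb{Z}^n$ with $M\in\mathbb{R}^{n\times n}$, $\det M\neq0$. For a $0$-symmetric convex body $H$, $H+\Lambda$ is a lattice packing of $H$ if $a-b\notin\operatorname{int}(2H)$ for all $a,b\in\Lambda$, $a\ne b$. Its packing density $\delta(H,\Lambda)$ is the asymptotic value of $|\Lambda\cap A|\,|H|/|A|$ for large convex bodies $A$, i.e. $\delta(H,\Lambda)=|H|/|\det M|$. The lattice packing density is $\delta_L(H)=\sup_\Lambda\delta(H,\Lambda)$, the supremum over all lattices $\Lambda$ of rank $n$ for which $H+\Lambda$ is a lattice packing of $H$. *)

theory Defs
  imports "HOL-Analysis.Analysis"
begin

definition convex_body :: "(real ^ 'n) set \<Rightarrow> bool" where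
  "convex_body A \<longleftrightarrow> compact A \<and> convex A \<and> interior A \<noteq> {}"

definition symmetric_convex_body :: "(real ^ 'n) set \<Rightarrow> bool" where
  "symmetric_convex_body A \<longleftrightarrow> convex_body A \<and> A = uminus ` A"

text \<open>Membership of the quadratic form in \<open>\<real>\<^sub>\<ge>\<^sub>0\<close> says that
  the complex number is real and nonnegative.\<close>

definition positive_definite_fun :: "(real ^ 'n \<Rightarrow> complex) \<Rightarrow> bool" where
  "positive_definite_fun f \<longleftrightarrow>
     continuous_on UNIV f \<and>
     (\<forall>Y c. finite Y \<longrightarrow> (\<Sum>a\<in>Y. \<Sum>b\<in>Y. c a * cnj (c b) * f (a - b)) \<in> \<real>\<^sub>\<ge>\<^sub>0)"

definition double_positive_definite :: "(real ^ 'n \<Rightarrow> real) \<Rightarrow> bool" where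
  "double_positive_definite f \<longleftrightarrow>
     positive_definite_fun (\<lambda>x. complex_of_real (f x)) \<and> (\<forall>x. f x \<ge> 0)"

definition mean_value :: "(real ^ 'n) set \<Rightarrow> (real ^ 'n \<Rightarrow> real) \<Rightarrow> real" where
  "mean_value A f = 1 / measure lebesgue A * (LINT x:A|lebesgue. f x)"

text \<open>The supremum is taken in the extended reals, so no boundedness is presupposed.
  The denominator is positive for \<open>f\<close> in the index set, because a positive definite
  function other than \<open>0\<close> satisfies \<open>f 0 > 0\<close>.\<close>

definition wiener_const :: "(real ^ 'n) set \<Rightarrow> (real ^ 'n) set \<Rightarrow> ereal" where
  "wiener_const U V =
     (SUP f\<in>{f. double_positive_definite f \<and> f \<noteq> (\<lambda>x. 0)}.
        ereal (mean_value V f / mean_value U f))"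

definition lattice_of :: "real ^ 'n ^ 'n \<Rightarrow> (real ^ 'n) set" where
  "lattice_of M = (\<lambda>z. M *v z) ` {z. \<forall>i. z $ i \<in> \<int>}"

definition full_rank_lattice :: "(real ^ 'n) set \<Rightarrow> bool" where
  "full_rank_lattice L \<longleftrightarrow> (\<exists>M. det M \<noteq> 0 \<and> L = lattice_of M)"

definition lattice_packing :: "(real ^ 'n) set \<Rightarrow> (real ^ 'n) set \<Rightarrow> bool" where
  "lattice_packing H L \<longleftrightarrow>
     (\<forall>a\<in>L. \<forall>b\<in>L. a \<noteq> b \<longrightarrow> a - b \<notin> interior ((\<lambda>x. 2 *\<^sub>R x) ` H))"

text \<open>The density of the packing is given in terms of a basis matrix of the lattice;
  \<open>\<bar>det M\<bar>\<close> is the covolume and does not depend on the choice of basis.\<close>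

definition packing_density :: "(real ^ 'n) set \<Rightarrow> real ^ 'n ^ 'n \<Rightarrow> real" where
  "packing_density H M = measure lebesgue H / \<bar>det M\<bar>"

definition lattice_packing_density :: "(real ^ 'n) set \<Rightarrow> ereal" where
  "lattice_packing_density H =
     (SUP M\<in>{M. det M \<noteq> 0 \<and> lattice_packing H (lattice_of M)}. ereal (packing_density H M))"

end

theory Submission
  imports Defs "HOL-Real_Asymp.Real_Asymp"
begin

text \<open>
  The test functions are sums of narrow bumps at differences of lattice points. Let \<open>tent e\<close> be the
  autocorrelation of the indicator of a cube of side \<open>e\<close>. For a finite point set \<open>K\<close>, the function
  \<open>\<Sum>u\<in>K. \<Sum>w\<in>K. tent e (x - (u - w))\<close> is continuous, nonnegative and positive definite, because
  its quadratic forms are integrals of squared absolute values. If no difference of two distinct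
  points of \<open>K\<close> lies in \<open>U\<close>, then for small \<open>e\<close> its integral over \<open>U\<close> only sees the \<open>card K\<close> bumps
  at \<open>0\<close>, whereas its integral over \<open>V\<close> sees one bump for each pair with \<open>u - w\<close> in the interior
  of \<open>V\<close> (\<open>wiener_const_ge_difference_set\<close>). Let \<open>K\<close> run through larger and larger boxes in a lattice.
  A fixed lattice vector is a difference of almost \<open>card K\<close> pairs from \<open>K\<close>, and in the limit each
  lattice point in the interior of \<open>V\<close> contributes \<open>card K\<close> bumps. This gives the first
  inequality for lattices whose nonzero vectors avoid \<open>U\<close>. A packing lattice of \<open>U / 2\<close> only
  avoids the interior of \<open>U\<close>, but enlarging it by a factor slightly above \<open>1\<close> makes it avoid \<open>U\<close>,
  and the finitely many lattice points inside \<open>V\<close> stay there (\<open>wiener_const_ge_lattice\<close>).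

  The second inequality would follow if \<open>V\<close> contained about \<open>|V| / |det M|\<close> lattice points. But \<open>V\<close> may
  have large volume and still be thin, so that a given lattice meets it in far too few points.
  The remedy is to perturb the lattice, depending on \<open>V\<close>. In lattice coordinates let \<open>W\<close> be the body,
  and let \<open>i\<close> be the coordinate in which it extends farthest. Replace each \<open>z\<close> in the integer lattice by
  \<open>z + z\<^sub>i w\<close> with \<open>w\<close> in the small cube \<open>[-\<eta>, \<eta>]\<^sup>n\<close>. When \<open>w\<close> is uniformly distributed, the sheared
  point is uniformly distributed in a cube of half-side \<open>\<eta> |z\<^sub>i|\<close>. At positions with large \<open>|x\<^sub>i|\<close> these
  cubes contain many lattice points, and the expected number of sheared points per unit volume is
  nearly \<open>1\<close> (\<open>lattice_density_near_point\<close>). The remaining slab, where \<open>|x\<^sub>i|\<close> is bounded, is a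
  small part of \<open>W\<close>, as many disjoint half-size copies of it fit into \<open>W\<close> along its long
  direction (\<open>measure_slab_le\<close>). Hence some \<open>w\<close> yields at least \<open>(1 - \<delta>) |W|\<close> sheared points in \<open>W\<close>
  (\<open>sheared_integer_points_in_large_body\<close>). If \<open>\<eta>\<close> is small compared with \<open>t\<close>, the sheared lattice
  enlarged by \<open>1 + t\<close> still packs (\<open>shear_keeps_avoiding\<close>), and the first inequality applies to it.
  Finally, the packing density is bounded by \<open>1\<close>, which is Minkowski's theorem
  (\<open>minkowski_convex_body\<close>), so the supremum over all packings is finite and is approached by a
  single lattice.
\<close>

section \<open>Volume of linear images\<close>

lemma det_matrix_elementary_shear:
  fixes m n :: "'n::finite"
  assumes "m \<noteq> n"
  shows "det (matrix (\<lambda>v::real^'n. \<chi> i. if i = m then v $ m + v $ n else v $ i)) = 1"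
proof -
  have "matrix (\<lambda>v::real^'n. \<chi> i. if i = m then v $ m + v $ n else v $ i)
      = (\<chi> k. if k = m then row m (mat 1) + 1 *s row n (mat 1) else row k (mat 1))"
    by (auto simp: matrix_def vec_eq_iff row_def mat_def axis_def)
  also have "det \<dots> = det (mat 1 :: real^'n^'n)"
    by (rule det_row_operation[OF assms])
  finally show ?thesis
    by (simp only: det_I)
qed

text \<open>Translating the box to the origin reduces this to boxes whose lower corner has nonnegative
  coordinates.\<close>

lemma measure_elementary_shear_cbox:
  fixes a b :: "real^'n"
  assumes "m \<noteq> n"
  defines "h \<equiv> (\<lambda>v::real^'n. \<chi> i. if i = m then v $ m + v $ n else v $ i)"
  shows "measure lebesgue (h ` cbox a b) = measure lebesgue (cbox a b)"
proof (cases "cbox a b = {}")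
  case False
  have shift: "cbox a b = (+) a ` cbox 0 (b - a)"
    using cbox_translation[of a 0 "b - a"] by simp
  then have ne: "cbox 0 (b - a) \<noteq> {}"
    using False by auto
  have "h (a + x) = h a + h x" for x
    by (auto simp: h_def vec_eq_iff)
  then have "h ` cbox a b = (+) (h a) ` h ` cbox 0 (b - a)"
    unfolding shift by (auto simp: image_image)
  then have "measure lebesgue (h ` cbox a b) = measure lebesgue (h ` cbox 0 (b - a))"
    by (simp only: measure_translation)
  also have "\<dots> = measure lebesgue (cbox 0 (b - a))"
    unfolding h_def using measure_shear_interval[OF assms(1) ne] by simp
  also have "\<dots> = measure lebesgue (cbox a b)"
    unfolding shift by (simp only: measure_translation)
  finally show ?thesis .
qed simp

lemma measure_coordinate_swap_cbox:
  fixes a b :: "real^'n"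
  shows "measure lebesgue ((\<lambda>v::real^'n. \<chi> i. v $ Transposition.transpose m n i) ` cbox a b)
    = measure lebesgue (cbox a b)"
proof -
  let ?t = "Transposition.transpose m n"
  let ?h = "\<lambda>v::real^'n. \<chi> i. v $ ?t i"
  have inv: "?h (?h v) = v" for v
    by (simp add: vec_eq_iff)
  have mem: "?h v \<in> cbox (?h a) (?h b) \<longleftrightarrow> v \<in> cbox a b" for v
  proof -
    have "(\<forall>i. P (?t i)) \<longleftrightarrow> (\<forall>i. P i)" for P
      by (metis transpose_involutory)
    from this[of "\<lambda>i. a $ i \<le> v $ i \<and> v $ i \<le> b $ i"] show ?thesis
      by (simp add: mem_box_cart)
  qed
  have "?h ` cbox a b = cbox (?h a) (?h b)"
  proof (intro subset_antisym subsetI)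
    fix x assume "x \<in> cbox (?h a) (?h b)"
    then have "?h x \<in> cbox a b"
      using mem[of "?h x"] by (simp only: inv)
    then show "x \<in> ?h ` cbox a b"
      by (rule image_eqI[rotated]) (simp only: inv)
  qed (auto simp only: mem)
  moreover have "(\<Prod>i\<in>UNIV. b $ ?t i - a $ ?t i) = (\<Prod>i\<in>UNIV. b $ i - a $ i)"
    by (rule prod.reindex_bij_betw[where g = "\<lambda>i. b $ i - a $ i"]) simp
  moreover have "cbox (?h a) (?h b) = {} \<longleftrightarrow> cbox a b = {}"
    using calculation(1) by (metis image_is_empty)
  ultimately show ?thesis
    by (simp add: content_cbox_if_cart)
qed

text \<open>The linear maps are generated by coordinate scalings, coordinate swaps, elementary shears and
  maps with a vanishing coordinate. On these generators the claim needs to be checked for boxes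
  only, and both sides are multiplicative. The index type carries no order, so the determinant of
  a shear is computed by a row operation and not by triangularity.\<close>

theorem measure_linear_image_cart:
  fixes f :: "real^'n \<Rightarrow> real^'n"
  assumes "linear f" "S \<in> lmeasurable"
  shows "f ` S \<in> lmeasurable \<and> measure lebesgue (f ` S) = \<bar>det (matrix f)\<bar> * measure lebesgue S"
proof -
  let ?P = "\<lambda>f. \<forall>S\<in>lmeasurable. f ` S \<in> lmeasurable \<and>
     measure lebesgue (f ` S) = \<bar>det (matrix f)\<bar> * measure lebesgue (S :: (real^'n) set)"
  have suff: "?P h" if "linear h" "\<bar>det (matrix h)\<bar> = 1"
    "\<And>a b. measure lebesgue (h ` cbox a b) = measure lebesgue (cbox a b)" for h
  proof
    fix S :: "(real^'n) set" assume "S \<in> lmeasurable"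
    moreover have "measure lebesgue (h ` cbox a b) = 1 * measure lebesgue (cbox a b)" for a b
      using that(3) by (simp only: mult_1)
    ultimately have "h ` S \<in> lmeasurable \<and> 1 * measure lebesgue S = measure lebesgue (h ` S)"
      using that(1) by (intro measure_linear_sufficient)
    then show "h ` S \<in> lmeasurable \<and> measure lebesgue (h ` S) = \<bar>det (matrix h)\<bar> * measure lebesgue S"
      by (simp only: that(2))
  qed
  have "?P f"
  proof (rule induct_linear_elementary[OF assms(1)])
    fix f g :: "real^'n \<Rightarrow> real^'n"
    assume "linear f" "linear g" "?P f" "?P g"
    then show "?P (f \<circ> g)"
      by (simp add: matrix_compose det_mul abs_mult image_comp[symmetric] del: o_apply image_comp)
  next
    fix f :: "real^'n \<Rightarrow> real^'n" and i
    assume lin: "linear f" and zero: "\<And>x. f x $ i = 0"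
    have "1 \<notin> range f"
      using zero by (metis (no_types) image_iff one_index zero_neq_one)
    then have "\<not> surj f"
      by blast
    then have ninj: "\<not> inj f"
      using linear_injective_imp_surjective[OF lin] by blast
    then have det0: "det (matrix f) = 0"
      using det_nz_iff_inj[OF lin] by blast
    show "?P f"
      using negligible_linear_singular_image[OF lin ninj] det0
      by (auto simp: negligible_iff_measure)
  next
    fix c :: "'n \<Rightarrow> real"
    have "matrix (\<lambda>x::real^'n. \<chi> i. c i * x $ i) = (\<chi> i j. if i = j then c i else 0)"
      by (auto simp: matrix_def axis_def vec_eq_iff)
    moreover have "det (\<chi> i j. if i = j then c i else 0 :: real^'n^'n) = prod c UNIV"
      by (subst det_diagonal) auto
    ultimately show "?P (\<lambda>x. \<chi> i. c i * x $ i)"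
      by (auto simp: measurable_stretch measure_stretch)
  next
    fix m n :: 'n
    assume "m \<noteq> n"
    let ?h = "\<lambda>v::real^'n. \<chi> i. v $ Transposition.transpose m n i"
    have "matrix ?h = (\<chi> i. (mat 1 :: real^'n^'n) $ Transposition.transpose m n i)"
      by (auto simp: matrix_def mat_def axis_def vec_eq_iff)
    then have "\<bar>det (matrix ?h)\<bar> = 1"
      by (simp add: det_permute_rows permutes_swap_id abs_mult sign_swap_id)
    moreover have "linear ?h"
      by (rule linearI) (auto simp: vec_eq_iff)
    ultimately show "?P ?h"
      using measure_coordinate_swap_cbox by (intro suff) auto
  next
    fix m n :: 'n
    assume "m \<noteq> n"
    let ?h = "\<lambda>v::real^'n. \<chi> i. if i = m then v $ m + v $ n else v $ i"
    have "linear ?h"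
      by (rule linearI) (auto simp: vec_eq_iff algebra_simps)
    then show "?P ?h"
      using det_matrix_elementary_shear[OF \<open>m \<noteq> n\<close>] measure_elementary_shear_cbox[OF \<open>m \<noteq> n\<close>]
      by (intro suff) auto
  qed
  then show ?thesis
    using assms(2) by blast
qed

section \<open>Positive definite functions from finite point sets\<close>

definition cube :: "real \<Rightarrow> real^'n \<Rightarrow> (real^'n) set" where
  "cube e a = cbox a (a + (\<chi> i. e))"

text \<open>Autocorrelation of the indicator function of a cube of side \<open>e\<close>, see \<open>measure_cube_Int_cube\<close>.
  The product formula makes continuity and the support visible.\<close>

definition tent :: "real \<Rightarrow> real^'n \<Rightarrow> real" where
  "tent e x = (\<Prod>i\<in>UNIV. max 0 (e - \<bar>x $ i\<bar>))"

lemma tent_nonneg: "tent e x \<ge> 0"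
  unfolding tent_def by (intro prod_nonneg) auto

lemma tent_eq_0: "\<not> (\<forall>i. \<bar>x $ i\<bar> \<le> e) \<Longrightarrow> tent e x = 0"
proof -
  assume "\<not> (\<forall>i. \<bar>x $ i\<bar> \<le> e)"
  then obtain i where "e < \<bar>x $ i\<bar>"
    by (auto simp: not_le)
  then have "max 0 (e - \<bar>x $ i\<bar>) = 0"
    by simp
  then show ?thesis
    unfolding tent_def by (intro prod_zero) auto
qed

lemma continuous_on_tent: "continuous_on A (\<lambda>x. tent e (x - d))"
  unfolding tent_def by (intro continuous_intros)

lemma borel_measurable_tent: "(\<lambda>x. tent e (x - d)) \<in> borel_measurable borel"
  by (intro borel_measurable_continuous_onI continuous_on_tent)

lemma measure_cube_Int_cube:
  fixes a b :: "real^'n"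
  assumes "e > 0"
  shows "measure lebesgue (cube e a \<inter> cube e b) = tent e (a - b)"
proof -
  let ?l = "\<chi> i. max (a $ i) (b $ i)" and ?r = "\<chi> i. min (a $ i) (b $ i) + e"
  have Int: "cube e a \<inter> cube e b = cbox ?l ?r"
    unfolding cube_def Int_interval_cart by (simp add: cbox_interval min_add_distrib_left)
  have side: "?r $ i - ?l $ i = e - \<bar>(a - b) $ i\<bar>" for i
    by (simp add: min_def max_def abs_if)
  show ?thesis
  proof (cases "\<forall>i. \<bar>(a - b) $ i\<bar> \<le> e")
    case True
    then have le: "?l $ i \<le> ?r $ i" for i
      using side[of i] by (smt (verit))
    then have "cbox ?l ?r \<noteq> {}"
      by (simp add: interval_ne_empty_cart)
    moreover have "(\<Prod>i\<in>UNIV. ?r $ i - ?l $ i) = tent e (a - b)"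
      unfolding tent_def side using True by (intro prod.cong) auto
    ultimately show ?thesis
      by (simp add: Int content_cbox_if_cart del: vec_lambda_beta)
  next
    case False
    then obtain i where "\<not> \<bar>(a - b) $ i\<bar> \<le> e"
      by blast
    then have "?r $ i < ?l $ i"
      using side[of i] by linarith
    then have "cbox ?l ?r = {}"
      unfolding interval_eq_empty_cart by blast
    then show ?thesis
      by (simp add: Int tent_eq_0[OF False])
  qed
qed

lemma lmeasurable_cube [simp]: "cube e a \<in> lmeasurable"
  by (simp add: cube_def)

text \<open>The quadratic form is the integral of \<open>|g|\<^sup>2\<close>, where \<open>g\<close> is the combination with coefficients
  \<open>c i\<close> of the indicators of the cubes at \<open>q i\<close>. The points \<open>q i\<close> may coincide, which lets the next
  lemma use differences \<open>a - u\<close> as a family indexed by pairs.\<close>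

lemma tent_gram_nonneg:
  fixes c :: "'i \<Rightarrow> complex" and q :: "'i \<Rightarrow> real^'n"
  assumes "finite I" "e > 0"
  shows "(\<Sum>i\<in>I. \<Sum>j\<in>I. c i * cnj (c j) * tent e (q i - q j)) \<in> \<real>\<^sub>\<ge>\<^sub>0"
proof -
  let ?B = "\<lambda>i. cube e (q i)"
  define g where "g y = (\<Sum>i\<in>I. c i * complex_of_real (indicat_real (?B i) y))" for y
  have int: "integrable lebesgue (\<lambda>y. complex_of_real (indicat_real (?B i \<inter> ?B j) y))" for i j
    by (intro integrable_of_real lmeasurable_iff_integrable[THEN iffD1] fmeasurable.Int lmeasurable_cube)
  have "(\<Sum>i\<in>I. \<Sum>j\<in>I. c i * cnj (c j) * tent e (q i - q j))
      = (\<Sum>i\<in>I. \<Sum>j\<in>I. LINT y|lebesgue. c i * cnj (c j) * complex_of_real (indicat_real (?B i \<inter> ?B j) y))"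
    using assms(2) by (intro sum.cong refl) (simp add: measure_cube_Int_cube)
  also have "\<dots> = (LINT y|lebesgue. (\<Sum>i\<in>I. \<Sum>j\<in>I. c i * cnj (c j) * complex_of_real (indicat_real (?B i \<inter> ?B j) y)))"
    using int by (simp add: Bochner_Integration.integral_sum)
  also have "\<dots> = (LINT y|lebesgue. complex_of_real ((cmod (g y))\<^sup>2))"
    by (intro Bochner_Integration.integral_cong refl)
      (simp add: complex_norm_square g_def sum_product indicator_inter_arith mult_ac del: of_real_power)
  also have "\<dots> = complex_of_real (LINT y|lebesgue. (cmod (g y))\<^sup>2)"
    by (rule integral_complex_of_real)
  finally show ?thesis
    by (simp add: Bochner_Integration.integral_nonneg)
qed

definition difference_tent :: "real \<Rightarrow> (real^'n) set \<Rightarrow> real^'n \<Rightarrow> real" where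
  "difference_tent e K x = (\<Sum>u\<in>K. \<Sum>w\<in>K. tent e (x - (u - w)))"

text \<open>With \<open>a - b - (u - w) = (a - u) - (b - w)\<close> the quadratic form over \<open>Y\<close> becomes one of \<open>tent e\<close>
  over \<open>Y \<times> K\<close>.\<close>

lemma double_positive_definite_difference_tent:
  fixes K :: "(real^'n) set"
  assumes "finite K" "e > 0"
  shows "double_positive_definite (difference_tent e K)"
  unfolding double_positive_definite_def positive_definite_fun_def
proof (intro conjI allI impI)
  show "continuous_on UNIV (\<lambda>x. complex_of_real (difference_tent e K x))"
    unfolding difference_tent_def by (intro continuous_intros continuous_on_tent)
next
  fix x show "difference_tent e K x \<ge> 0"
    unfolding difference_tent_def by (intro sum_nonneg tent_nonneg)
next
  fix Y :: "(real^'n) set" and c :: "real^'n \<Rightarrow> complex"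
  assume "finite Y"
  have "(\<Sum>a\<in>Y. \<Sum>b\<in>Y. c a * cnj (c b) * difference_tent e K (a - b))
      = (\<Sum>a\<in>Y. \<Sum>b\<in>Y. \<Sum>u\<in>K. \<Sum>w\<in>K. c a * cnj (c b) * tent e ((a - u) - (b - w)))"
    by (simp add: difference_tent_def sum_distrib_left algebra_simps)
  also have "\<dots> = (\<Sum>a\<in>Y. \<Sum>u\<in>K. \<Sum>b\<in>Y. \<Sum>w\<in>K. c a * cnj (c b) * tent e ((a - u) - (b - w)))"
    by (intro sum.cong refl sum.swap)
  also have "\<dots> = (\<Sum>i\<in>Y\<times>K. \<Sum>j\<in>Y\<times>K. c (fst i) * cnj (c (fst j)) *
      tent e ((fst i - snd i) - (fst j - snd j)))"
    by (simp add: sum.cartesian_product')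
  also have "\<dots> \<in> \<real>\<^sub>\<ge>\<^sub>0"
    using \<open>finite Y\<close> assms by (intro tent_gram_nonneg) auto
  finally show "(\<Sum>a\<in>Y. \<Sum>b\<in>Y. c a * cnj (c b) * difference_tent e K (a - b)) \<in> \<real>\<^sub>\<ge>\<^sub>0" .
qed

lemma integrable_tent: "integrable lebesgue (\<lambda>x. tent e (x - d))" for d :: "real^'n"
proof -
  let ?C = "cbox (d - (\<chi> i. e)) (d + (\<chi> i. e))"
  have "indicator ?C x *\<^sub>R tent e (x - d) = tent e (x - d)" for x
  proof (cases "\<forall>i. \<bar>(x - d) $ i\<bar> \<le> e")
    case True
    have "d $ i - e \<le> x $ i \<and> x $ i \<le> d $ i + e" for i
      using True[rule_format, of i] by (auto simp: abs_le_iff)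
    then have "x \<in> ?C"
      by (simp add: mem_box_cart)
    then show ?thesis by simp
  qed (simp add: tent_eq_0)
  then have "(\<lambda>x. indicator ?C x *\<^sub>R tent e (x - d)) = (\<lambda>x. tent e (x - d))"
    by (intro ext)
  then have "integrable lborel (\<lambda>x. tent e (x - d))"
    using borel_integrable_compact[OF compact_cbox continuous_on_tent, of "d - (\<chi> i. e)" "d + (\<chi> i. e)" e d]
    by (simp only:)
  then show ?thesis
    using borel_measurable_tent by (simp add: integrable_completion)
qed

lemma integral_tent_translate:
  fixes d :: "real^'n"
  shows "(LINT x|lebesgue. tent e (x - d)) = (LINT x|lebesgue. tent e (x :: real^'n))"
proof -
  have "(LINT x|lebesgue. tent e (x - d)) = (LINT x|lborel. tent e (- d + x))"
    using borel_measurable_tent[of e d] by (simp add: integral_completion)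
  also have "\<dots> = (LINT x|distr lborel borel ((+) (- d)). tent e x)"
    using borel_measurable_tent[of e 0] by (subst integral_distr) auto
  also have "\<dots> = (LINT x|lebesgue. tent e (x :: real^'n))"
    unfolding lborel_distr_plus using borel_measurable_tent[of e 0]
    by (intro integral_completion[symmetric]) simp_all
  finally show ?thesis .
qed

lemma integral_tent_pos:
  assumes "e > 0"
  shows "(LINT x|lebesgue. tent e (x :: real^'n)) > 0"
proof -
  let ?C = "cbox (- (\<chi> i. e / 2)) (\<chi> i. e / 2) :: (real^'n) set"
  have "0 < (e / 2) ^ CARD('n) * measure lebesgue ?C"
    using assms by (simp add: content_cbox_if_cart interval_eq_empty_cart)
  also have "\<dots> = (LINT x|lebesgue. (e / 2) ^ CARD('n) * indicat_real ?C x)"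
    by simp
  also have "\<dots> \<le> (LINT x|lebesgue. tent e (x :: real^'n))"
  proof (rule Bochner_Integration.integral_mono)
    show "integrable lebesgue (\<lambda>x. (e / 2) ^ CARD('n) * indicat_real ?C x)"
      by (intro integrable_mult_right lmeasurable_iff_integrable[THEN iffD1]) simp
    show "integrable lebesgue (\<lambda>x::real^'n. tent e x)"
      using integrable_tent[of e 0] by simp
    fix x :: "real^'n"
    show "(e / 2) ^ CARD('n) * indicat_real ?C x \<le> tent e x"
    proof (cases "x \<in> ?C")
      case True
      then have "- (e / 2) \<le> x $ i \<and> x $ i \<le> e / 2" for i
        by (simp add: mem_box_cart)
      then have "\<bar>x $ i\<bar> \<le> e / 2" for i
        by (simp only: abs_le_iff minus_le_iff)
      then have "(\<Prod>i\<in>(UNIV::'n set). e / 2) \<le> tent e x"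
        unfolding tent_def using assms by (intro prod_mono) (smt (verit) field_sum_of_halves)
      with True show ?thesis by simp
    qed (simp add: tent_nonneg)
  qed
  finally show ?thesis .
qed

lemma set_integral_tent_inside:
  fixes d :: "real^'n"
  assumes "\<And>x. (\<forall>i. \<bar>x $ i - d $ i\<bar> \<le> e) \<Longrightarrow> x \<in> A"
  shows "(LINT x:A|lebesgue. tent e (x - d)) = (LINT x|lebesgue. tent e (x :: real^'n))"
proof -
  have "(\<lambda>x. indicator A x *\<^sub>R tent e (x - d)) = (\<lambda>x. tent e (x - d))"
    using assms tent_eq_0[of "x - d" e for x] by (fastforce simp: indicator_def)
  then show ?thesis
    unfolding set_lebesgue_integral_def by (simp only: integral_tent_translate)
qed

lemma set_integral_tent_outside:
  fixes d :: "real^'n"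
  assumes "\<And>x. (\<forall>i. \<bar>x $ i - d $ i\<bar> \<le> e) \<Longrightarrow> x \<notin> A"
  shows "(LINT x:A|lebesgue. tent e (x - d)) = 0"
proof -
  have "(\<lambda>x. indicator A x *\<^sub>R tent e (x - d)) = (\<lambda>x. 0)"
    using assms tent_eq_0[of "x - d" e for x] by (fastforce simp: indicator_def)
  then show ?thesis
    unfolding set_lebesgue_integral_def by simp
qed

lemma set_integral_difference_tent:
  assumes "A \<in> sets lebesgue"
  shows "(LINT x:A|lebesgue. difference_tent e K x)
    = (\<Sum>u\<in>K. \<Sum>w\<in>K. LINT x:A|lebesgue. tent e (x - (u - w)))"
proof -
  have "integrable lebesgue (\<lambda>x. indicator A x * tent e (x - d))" for d
    using integrable_mult_indicator[OF assms integrable_tent] by simp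
  then show ?thesis
    by (simp add: set_lebesgue_integral_def difference_tent_def sum_distrib_left
        Bochner_Integration.integral_sum)
qed

lemma eventually_small_box_subset_open:
  fixes d :: "real^'n"
  assumes "open S" "d \<in> S"
  shows "\<forall>\<^sub>F e in at_right 0. \<forall>x. (\<forall>i. \<bar>x $ i - d $ i\<bar> \<le> e) \<longrightarrow> x \<in> S"
proof -
  obtain r where r: "r > 0" "ball d r \<subseteq> S"
    using assms openE by blast
  have "\<forall>\<^sub>F e in at_right 0. e < r / CARD('n)"
    using r by (intro eventually_at_right_less[THEN eventually_mono] eventually_at_rightI[of 0 "r / CARD('n)"]) auto
  then show ?thesis
  proof eventually_elim
    case (elim e)
    show ?case
    proof (intro allI impI)
      fix x assume x: "\<forall>i. \<bar>x $ i - d $ i\<bar> \<le> e"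
      have "norm (x - d) \<le> (\<Sum>i\<in>UNIV. \<bar>(x - d) $ i\<bar>)"
        by (rule norm_le_l1_cart)
      also have "\<dots> \<le> (\<Sum>i\<in>(UNIV::'n set). e)"
        using x by (intro sum_mono) auto
      also have "\<dots> < r"
        using elim by (simp add: field_simps)
      finally show "x \<in> S"
        using r(2) by (auto simp: dist_norm norm_minus_commute)
    qed
  qed
qed

lemma measure_convex_body_pos:
  assumes "convex_body A"
  shows "measure lebesgue A > 0"
proof -
  have lm: "A \<in> lmeasurable" and ne: "interior A \<noteq> {}"
    using assms by (auto simp: convex_body_def lmeasurable_compact)
  have "\<not> negligible A"
    using ne interior_subset negligible_subset open_interior open_not_negligible by metis
  then have "measure lebesgue A \<noteq> 0"
    using lm by (simp add: negligible_iff_measure)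
  then show ?thesis
    using measure_nonneg[of lebesgue A] by linarith
qed

lemma zero_in_interior_symmetric_convex_body:
  assumes "symmetric_convex_body A"
  shows "0 \<in> interior A"
proof -
  obtain x where x: "x \<in> interior A" and conv: "convex A" and sym: "A = uminus ` A"
    using assms by (auto simp: symmetric_convex_body_def convex_body_def)
  have "interior A = uminus ` interior A"
    using sym interior_negations by metis
  then have "- x \<in> interior A"
    using x by blast
  with x have "(1/2) *\<^sub>R x + (1/2) *\<^sub>R (- x) \<in> interior A"
    using convex_interior[OF conv] by (intro convexD) auto
  then show ?thesis by simp
qed

text \<open>For small \<open>e\<close>, each bump of \<open>difference_tent e K\<close> that is centred at a nonzero difference misses
  \<open>U\<close>, the bumps at \<open>0\<close> lie in \<open>U\<close>, and each bump centred in the interior of \<open>V\<close> lies in \<open>V\<close>. All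
  bumps have the same integral, so the ratio of mean values becomes a ratio of counts.\<close>

theorem wiener_const_ge_difference_set:
  fixes K U V :: "(real^'n) set"
  assumes U: "symmetric_convex_body U" and V: "symmetric_convex_body V"
    and K: "finite K" "K \<noteq> {}"
    and sep: "\<And>u w. u \<in> K \<Longrightarrow> w \<in> K \<Longrightarrow> u \<noteq> w \<Longrightarrow> u - w \<notin> U"
  shows "wiener_const U V \<ge> ereal (real (card {(u, w). u \<in> K \<and> w \<in> K \<and> u - w \<in> interior V}) / card K
           * (measure lebesgue U / measure lebesgue V))"
proof -
  have bodies: "convex_body U" "convex_body V"
    using U V by (auto simp: symmetric_convex_body_def)
  then have "closed U" and lm: "U \<in> sets lebesgue" "V \<in> sets lebesgue"
    by (auto simp: convex_body_def compact_imp_closed fmeasurableD[OF lmeasurable_compact])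
  have fin: "finite {(u, w). u \<in> K \<and> w \<in> K \<and> Q u w}" for Q
    by (rule finite_subset[of _ "K \<times> K"]) (use K in auto)
  let ?box = "\<lambda>e d. {x. \<forall>i. \<bar>x $ i - d $ i\<bar> \<le> e} :: (real^'n) set"
  have "\<forall>\<^sub>F e in at_right 0. e > (0::real)"
    by (rule eventually_at_right_less)
  moreover have "\<forall>\<^sub>F e in at_right 0. ?box e 0 \<subseteq> U"
    using eventually_small_box_subset_open[OF open_interior zero_in_interior_symmetric_convex_body[OF U]]
    by eventually_elim (use interior_subset in auto)
  moreover have "\<forall>\<^sub>F e in at_right 0. \<forall>p\<in>K\<times>K. fst p \<noteq> snd p \<longrightarrow> ?box e (fst p - snd p) \<subseteq> - U"
  proof (intro eventually_ball_finite ballI)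
    fix p assume p: "p \<in> K \<times> K"
    show "\<forall>\<^sub>F e in at_right 0. fst p \<noteq> snd p \<longrightarrow> ?box e (fst p - snd p) \<subseteq> - U"
    proof (cases "fst p = snd p")
      case False
      with p have "fst p - snd p \<in> - U"
        using sep by auto
      from eventually_small_box_subset_open[OF open_Compl[OF \<open>closed U\<close>] this]
      show ?thesis by eventually_elim auto
    qed simp
  qed (use K in simp)
  moreover have "\<forall>\<^sub>F e in at_right 0. \<forall>p\<in>K\<times>K. fst p - snd p \<in> interior V \<longrightarrow> ?box e (fst p - snd p) \<subseteq> V"
  proof (intro eventually_ball_finite ballI)
    fix p assume "p \<in> K \<times> K"
    show "\<forall>\<^sub>F e in at_right 0. fst p - snd p \<in> interior V \<longrightarrow> ?box e (fst p - snd p) \<subseteq> V"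
    proof (cases "fst p - snd p \<in> interior V")
      case True
      from eventually_small_box_subset_open[OF open_interior this]
      show ?thesis by eventually_elim (use interior_subset in auto)
    qed simp
  qed (use K in simp)
  ultimately have "\<forall>\<^sub>F e in at_right 0. e > 0 \<and> ?box e 0 \<subseteq> U \<and>
     (\<forall>p\<in>K\<times>K. fst p \<noteq> snd p \<longrightarrow> ?box e (fst p - snd p) \<subseteq> - U) \<and>
     (\<forall>p\<in>K\<times>K. fst p - snd p \<in> interior V \<longrightarrow> ?box e (fst p - snd p) \<subseteq> V)"
    by eventually_elim blast
  then obtain e where e: "e > 0" and U0: "?box e 0 \<subseteq> U"
    and Ud: "\<And>u w. u \<in> K \<Longrightarrow> w \<in> K \<Longrightarrow> u \<noteq> w \<Longrightarrow> ?box e (u - w) \<subseteq> - U"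
    and Vd: "\<And>u w. u \<in> K \<Longrightarrow> w \<in> K \<Longrightarrow> u - w \<in> interior V \<Longrightarrow> ?box e (u - w) \<subseteq> V"
    by (force dest!: eventually_happens)
  define f where "f = difference_tent e K"
  define J where "J = (LINT x|lebesgue. tent e (x :: real^'n))"
  define P where "P = {(u, w). u \<in> K \<and> w \<in> K \<and> u - w \<in> interior V}"
  have J: "J > 0"
    unfolding J_def by (rule integral_tent_pos[OF e])
  have "(LINT x:U|lebesgue. f x) = (\<Sum>u\<in>K. \<Sum>w\<in>K. if u = w then J else 0)"
    unfolding f_def set_integral_difference_tent[OF lm(1)]
  proof (intro sum.cong refl)
    fix u w assume "u \<in> K" "w \<in> K"
    show "(LINT x:U|lebesgue. tent e (x - (u - w))) = (if u = w then J else 0)"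
    proof (cases "u = w")
      case True
      then show ?thesis
        using set_integral_tent_inside[of "0" e U] U0 by (auto simp: J_def)
    next
      case False
      then show ?thesis
        using Ud[OF \<open>u \<in> K\<close> \<open>w \<in> K\<close>] by (simp, intro set_integral_tent_outside) auto
    qed
  qed
  then have intU: "(LINT x:U|lebesgue. f x) = card K * J"
    using K by simp
  have "card P * J = (\<Sum>u\<in>K. \<Sum>w\<in>K. if u - w \<in> interior V then J else 0)"
  proof -
    have "(\<Sum>u\<in>K. \<Sum>w\<in>K. if u - w \<in> interior V then J else 0)
        = (\<Sum>p\<in>K\<times>K. if p \<in> P then J else 0)"
      unfolding sum.cartesian_product by (intro sum.cong) (auto simp: P_def split: if_splits)
    also have "\<dots> = (\<Sum>p\<in>P. J)"
      using K by (intro sum.mono_neutral_cong_right) (auto simp: P_def split: if_splits)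
    finally show ?thesis by simp
  qed
  also have "\<dots> \<le> (LINT x:V|lebesgue. f x)"
    unfolding f_def set_integral_difference_tent[OF lm(2)]
  proof (intro sum_mono)
    fix u w assume "u \<in> K" "w \<in> K"
    show "(if u - w \<in> interior V then J else 0) \<le> (LINT x:V|lebesgue. tent e (x - (u - w)))"
    proof (cases "u - w \<in> interior V")
      case True
      have "(LINT x:V|lebesgue. tent e (x - (u - w))) = J"
        unfolding J_def using Vd[OF \<open>u \<in> K\<close> \<open>w \<in> K\<close> True] by (intro set_integral_tent_inside) auto
      with True show ?thesis by simp
    next
      case False
      then show ?thesis
        by (simp add: set_lebesgue_integral_def tent_nonneg Bochner_Integration.integral_nonneg)
    qed
  qed
  finally have intV: "card P * J \<le> (LINT x:V|lebesgue. f x)" .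
  have mpos: "measure lebesgue U > 0" "measure lebesgue V > 0"
    using bodies by (auto intro: measure_convex_body_pos)
  have cpos: "real (card K) > 0"
    using K by (simp add: card_gt_0_iff)
  have "real (card P) / card K * (measure lebesgue U / measure lebesgue V)
      = (1 / measure lebesgue V * (card P * J)) / (1 / measure lebesgue U * (card K * J))"
    using J mpos cpos by (simp add: field_simps)
  also have "\<dots> \<le> mean_value V f / mean_value U f"
    unfolding mean_value_def intU using intV J mpos cpos
    by (intro divide_right_mono mult_left_mono) auto
  finally have ratio: "real (card P) / card K * (measure lebesgue U / measure lebesgue V)
      \<le> mean_value V f / mean_value U f" .
  have "f \<noteq> (\<lambda>x. 0)"
    using intU J cpos by (auto simp: set_lebesgue_integral_def)
  moreover have "double_positive_definite f"
    unfolding f_def by (rule double_positive_definite_difference_tent[OF K(1) e])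
  ultimately have "ereal (mean_value V f / mean_value U f) \<le> wiener_const U V"
    unfolding wiener_const_def by (intro SUP_upper) auto
  with ratio show ?thesis
    unfolding P_def by (meson ereal_less_eq(3) order_trans)
qed

section \<open>Lattice points in the interior of \<open>V\<close>\<close>

definition integer_points :: "(real^'n) set" where
  "integer_points = {z. \<forall>i. z $ i \<in> \<int>}"

definition integer_box :: "nat \<Rightarrow> (real^'n) set" where
  "integer_box N = {z \<in> integer_points. \<forall>i. \<bar>z $ i\<bar> \<le> real N}"

lemma integer_points_add: "x \<in> integer_points \<Longrightarrow> y \<in> integer_points \<Longrightarrow> x + y \<in> integer_points"
  and integer_points_diff: "x \<in> integer_points \<Longrightarrow> y \<in> integer_points \<Longrightarrow> x - y \<in> integer_points"
  by (auto simp: integer_points_def)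

lemma zero_integer_point: "0 \<in> integer_points"
  by (simp add: integer_points_def)

text \<open>Integer points of a cube as a product of integer intervals, so that they can be counted one
  coordinate at a time.\<close>

lemma bij_betw_integer_points_near:
  fixes x :: "real^'n"
  shows "bij_betw (\<lambda>f. \<chi> i. real_of_int (f i)) (PiE UNIV (\<lambda>i. {\<lceil>x $ i - r\<rceil>..\<lfloor>x $ i + r\<rfloor>}))
    {z \<in> integer_points. \<forall>i. \<bar>z $ i - x $ i\<bar> \<le> r}"
    (is "bij_betw ?h ?P ?Z")
proof (rule bij_betwI[where g = "\<lambda>z i. \<lfloor>z $ i\<rfloor>"])
  show "?h \<in> ?P \<rightarrow> ?Z"
  proof
    fix f assume "f \<in> ?P"
    then have "f i \<in> {\<lceil>x $ i - r\<rceil>..\<lfloor>x $ i + r\<rfloor>}" for i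
      by (rule PiE_mem) simp
    then have "x $ i - r \<le> real_of_int (f i) \<and> real_of_int (f i) \<le> x $ i + r" for i
      by (simp add: ceiling_le_iff le_floor_iff)
    then show "?h f \<in> ?Z"
      by (simp add: integer_points_def abs_diff_le_iff)
  qed
  show "(\<lambda>z i. \<lfloor>z $ i\<rfloor>) \<in> ?Z \<rightarrow> ?P"
  proof
    fix z assume z: "z \<in> ?Z"
    then have floor: "real_of_int \<lfloor>z $ i\<rfloor> = z $ i" for i
      by (auto simp: integer_points_def elim!: Ints_cases)
    have "x $ i - r \<le> z $ i" "z $ i \<le> x $ i + r" for i
      using z by (auto simp: abs_diff_le_iff)
    then have "\<lceil>x $ i - r\<rceil> \<le> \<lfloor>z $ i\<rfloor> \<and> \<lfloor>z $ i\<rfloor> \<le> \<lfloor>x $ i + r\<rfloor>" for i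
      by (simp only: ceiling_le_iff floor floor_mono simp_thms)
    then show "(\<lambda>i. \<lfloor>z $ i\<rfloor>) \<in> ?P"
      by (intro PiE_I) auto
  qed
  show "?h (\<lambda>i. \<lfloor>z $ i\<rfloor>) = z" if "z \<in> ?Z" for z
    using that by (auto simp: integer_points_def vec_eq_iff elim!: Ints_cases)
qed auto

lemma finite_integer_points_near:
  "finite {z \<in> integer_points. \<forall>i. \<bar>z $ i - x $ i\<bar> \<le> r}" for x :: "real^'n"
  using bij_betw_finite[OF bij_betw_integer_points_near] by (simp add: finite_PiE)

lemma card_integer_points_near:
  "card {z \<in> integer_points. \<forall>i. \<bar>z $ i - x $ i\<bar> \<le> r}
    = (\<Prod>i\<in>UNIV. nat (\<lfloor>x $ i + r\<rfloor> - \<lceil>x $ i - r\<rceil> + 1))" for x :: "real^'n"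
  using bij_betw_same_card[OF bij_betw_integer_points_near[of x r]] by (simp add: card_PiE add.commute)

lemma card_integer_points_near_ge:
  fixes x :: "real^'n" and r :: real
  assumes "2 * r \<ge> 1"
  shows "card {z \<in> integer_points. \<forall>i. \<bar>z $ i - x $ i\<bar> \<le> r} \<ge> (2 * r - 1) ^ CARD('n)"
proof -
  have "(2 * r - 1) ^ CARD('n) = (\<Prod>i\<in>(UNIV::'n set). 2 * r - 1)"
    by simp
  also have "\<dots> \<le> (\<Prod>i\<in>UNIV. real (nat (\<lfloor>x $ i + r\<rfloor> - \<lceil>x $ i - r\<rceil> + 1)))"
    using assms by (intro prod_mono conjI) linarith+
  finally show ?thesis
    by (simp add: card_integer_points_near)
qed

lemma integer_box_eq: "integer_box N = {z \<in> integer_points. \<forall>i. \<bar>z $ i - (0 :: real^'n) $ i\<bar> \<le> real N}"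
  by (simp add: integer_box_def)

lemma finite_integer_box: "finite (integer_box N :: (real^'n) set)"
  unfolding integer_box_eq by (rule finite_integer_points_near)

lemma card_integer_box: "card (integer_box N :: (real^'n) set) = (2 * N + 1) ^ CARD('n)"
proof -
  have "nat (2 * int N + 1) = 2 * N + 1"
    by simp
  then show ?thesis
    unfolding integer_box_eq card_integer_points_near by (simp add: ceiling_minus)
qed

lemma integer_box_add:
  "x \<in> integer_box M \<Longrightarrow> y \<in> integer_box N \<Longrightarrow> x + y \<in> integer_box (M + N)"
  unfolding integer_box_def
  by (auto intro: integer_points_add order_trans[OF abs_triangle_ineq add_mono])

lemma bounded_integer_points_in_box:
  assumes "bounded B"
  obtains N where "integer_points \<inter> B \<subseteq> integer_box N"
proof -
  obtain b where b: "\<And>x. x \<in> B \<Longrightarrow> norm x \<le> b"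
    using assms bounded_iff by blast
  obtain N where "b \<le> real N"
    using real_arch_simple by blast
  then have "integer_points \<inter> B \<subseteq> integer_box N"
    using b component_le_norm_cart by (fastforce simp: integer_box_def intro: order_trans)
  then show ?thesis using that by blast
qed

lemma finite_lattice_points_bounded:
  fixes f :: "real^'n \<Rightarrow> real^'n"
  assumes "linear f" "inj f" "bounded B"
  shows "finite {z \<in> integer_points. f z \<in> B}"
proof -
  obtain g where g: "linear g" "g \<circ> f = id"
    using linear_injective_left_inverse[OF assms(1,2)] by blast
  have "bounded (g ` B)"
    using assms(3) g(1) by (simp add: bounded_linear_image linear_conv_bounded_linear)
  then obtain N where N: "integer_points \<inter> g ` B \<subseteq> integer_box N"
    by (rule bounded_integer_points_in_box)
  have "z = g (f z)" for z
    using g(2) by (metis comp_apply id_apply)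
  then have "{z \<in> integer_points. f z \<in> B} \<subseteq> integer_box N"
    using N by blast
  then show ?thesis
    using finite_integer_box finite_subset by blast
qed

text \<open>Take for \<open>K\<close> the image of the integer box of half-side \<open>N + D\<close>, where \<open>D\<close> bounds the coordinates
  in \<open>S\<close>. Every \<open>w\<close> in the box of half-side \<open>N\<close> and every \<open>d \<in> S\<close> give a pair \<open>(w + d, w)\<close> with
  difference \<open>d\<close>, so the loss factor is the ratio of the sizes of the two boxes, which tends to \<open>1\<close>.\<close>

lemma wiener_const_ge_lattice_avoiding:
  fixes f :: "real^'n \<Rightarrow> real^'n"
  assumes U: "symmetric_convex_body U" and V: "symmetric_convex_body V"
    and f: "linear f" "inj f"
    and avoid: "\<And>z. z \<in> integer_points \<Longrightarrow> z \<noteq> 0 \<Longrightarrow> f z \<notin> U"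
    and S: "finite S" "S \<subseteq> integer_points" "f ` S \<subseteq> interior V"
  shows "wiener_const U V \<ge> ereal (real (card S) * (measure lebesgue U / measure lebesgue V))"
proof -
  let ?n = "CARD('n)" and ?q = "measure lebesgue U / measure lebesgue V"
  obtain D where "integer_points \<inter> S \<subseteq> integer_box D"
    using S(1) by (auto intro: bounded_integer_points_in_box finite_imp_bounded)
  then have D: "S \<subseteq> integer_box D"
    using S(2) by blast
  have inj: "inj_on f A" for A
    using f(2) by (rule inj_on_subset) simp
  let ?r = "\<lambda>N. real (2 * N + 1) ^ ?n / real (2 * (N + D) + 1) ^ ?n"
  have bound: "ereal (card S * ?r N * ?q) \<le> wiener_const U V" for N
  proof -
    define K where "K = f ` integer_box (N + D)"
    define P where "P = {(u, w). u \<in> K \<and> w \<in> K \<and> u - w \<in> interior V}"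
    have cK: "card K = (2 * (N + D) + 1) ^ ?n"
      unfolding K_def by (simp only: card_image[OF inj] card_integer_box)
    have finK: "finite K"
      unfolding K_def by (intro finite_imageI finite_integer_box)
    have finP: "finite P"
      by (rule finite_subset[of _ "K \<times> K"]) (use finK in \<open>auto simp: P_def\<close>)
    let ?p = "\<lambda>(w, d). (f (w + d), f w)"
    let ?Q = "(integer_box N :: (real^'n) set) \<times> S"
    have "inj_on ?p ?Q"
      by (auto simp: inj_on_def inj_eq[OF f(2)])
    then have "card ?Q = card (?p ` ?Q)"
      by (simp add: card_image)
    also have "\<dots> \<le> card P"
    proof (intro card_mono finP subsetI)
      fix x assume "x \<in> ?p ` ?Q"
      then obtain w d where x: "x = (f (w + d), f w)" and w: "w \<in> integer_box N" and d: "d \<in> S"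
        by auto
      have "w + d \<in> integer_box (N + D)"
        using w d D by (intro integer_box_add) auto
      moreover have "w \<in> integer_box (N + D)"
        using w by (auto simp: integer_box_def intro: order_trans)
      moreover have "f (w + d) - f w \<in> interior V"
        using S(3) d by (auto simp: linear_add[OF f(1)])
      ultimately show "x \<in> P"
        by (simp add: x P_def K_def)
    qed
    finally have "(2 * N + 1) ^ ?n * card S \<le> card P"
      by (simp add: card_cartesian_product card_integer_box)
    then have "real ((2 * N + 1) ^ ?n * card S) \<le> card P"
      by (simp only: of_nat_le_iff)
    then have "real (2 * N + 1) ^ ?n * card S \<le> card P"
      by (simp only: of_nat_mult of_nat_power)
    then have "card S * ?r N \<le> card P / card K"
      unfolding cK by (simp add: divide_right_mono mult.commute)
    then have "card S * ?r N * ?q \<le> card P / card K * ?q"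
      by (intro mult_right_mono) auto
    moreover have "ereal (card P / card K * ?q) \<le> wiener_const U V"
      unfolding P_def
    proof (rule wiener_const_ge_difference_set[OF U V finK])
      show "K \<noteq> {}"
        using cK by (auto simp del: of_nat_Suc)
      fix u w assume "u \<in> K" "w \<in> K" "u \<noteq> w"
      then obtain x y where "x \<in> integer_points" "y \<in> integer_points" "u = f x" "w = f y" "x \<noteq> y"
        by (auto simp: K_def integer_box_def)
      then show "u - w \<notin> U"
        using avoid[of "x - y"] by (simp add: linear_diff[OF f(1)] integer_points_diff)
    qed
    ultimately show ?thesis
      by (meson ereal_less_eq(3) order_trans)
  qed
  have "(\<lambda>N. real (2 * N + 1) / real (2 * (N + D) + 1)) \<longlonglongrightarrow> 1"
    by real_asymp
  then have "(\<lambda>N. (real (2 * N + 1) / real (2 * (N + D) + 1)) ^ ?n) \<longlonglongrightarrow> 1 ^ ?n"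
    by (intro tendsto_power)
  then have "?r \<longlonglongrightarrow> 1"
    by (simp add: power_divide)
  then have "(\<lambda>N. card S * ?r N * ?q) \<longlonglongrightarrow> real (card S) * 1 * ?q"
    by (intro tendsto_intros)
  then have "(\<lambda>N. ereal (card S * ?r N * ?q)) \<longlonglongrightarrow> ereal (real (card S) * 1 * ?q)"
    by (simp only: lim_ereal)
  then show ?thesis
    using Lim_bounded[of _ _ 0] bound by fastforce
qed

text \<open>Lattice vectors on the boundary of \<open>U\<close> would add bumps to the integral over \<open>U\<close>. Dilating the
  lattice by \<open>1 + t\<close> moves them out of \<open>U\<close>, and since \<open>S\<close> is finite and the interior of \<open>V\<close> is
  open, a small \<open>t\<close> keeps all of \<open>S\<close> inside. Thus nothing is lost in the bound.\<close>

theorem wiener_const_ge_lattice: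
  fixes f :: "real^'n \<Rightarrow> real^'n"
  assumes U: "symmetric_convex_body U" and V: "symmetric_convex_body V"
    and f: "linear f" "inj f"
    and avoid: "\<And>z. z \<in> integer_points \<Longrightarrow> z \<noteq> 0 \<Longrightarrow> f z \<notin> interior U"
    and S: "finite S" "S \<subseteq> integer_points" "f ` S \<subseteq> interior V"
  shows "wiener_const U V \<ge> ereal (real (card S) * (measure lebesgue U / measure lebesgue V))"
proof -
  have "\<forall>\<^sub>F t in at_right 0. \<forall>z\<in>S. (1 + t) *\<^sub>R f z \<in> interior V"
  proof (intro eventually_ball_finite S(1) ballI)
    fix z assume "z \<in> S"
    have "((\<lambda>t. (1 + t) *\<^sub>R f z) \<longlongrightarrow> (1 + 0) *\<^sub>R f z) (at_right 0)"
      by (intro tendsto_intros)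
    then show "\<forall>\<^sub>F t in at_right 0. (1 + t) *\<^sub>R f z \<in> interior V"
      using S(3) \<open>z \<in> S\<close> by (intro topological_tendstoD) auto
  qed
  moreover have "\<forall>\<^sub>F t in at_right 0. t > (0::real)"
    by (rule eventually_at_right_less)
  ultimately have "\<forall>\<^sub>F t in at_right 0. t > 0 \<and> (\<forall>z\<in>S. (1 + t) *\<^sub>R f z \<in> interior V)"
    by eventually_elim blast
  then obtain t :: real where t: "t > 0" and St: "\<And>z. z \<in> S \<Longrightarrow> (1 + t) *\<^sub>R f z \<in> interior V"
    by (force dest!: eventually_happens)
  have conv: "convex U"
    using U by (simp add: symmetric_convex_body_def convex_body_def)
  show ?thesis
  proof (rule wiener_const_ge_lattice_avoiding[OF U V, of "\<lambda>x. (1 + t) *\<^sub>R f x"])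
    show "linear (\<lambda>x. (1 + t) *\<^sub>R f x)"
      using f(1) by (rule linear_compose_scale_right)
    show "inj (\<lambda>x. (1 + t) *\<^sub>R f x)"
      using f(2) t by (auto simp: inj_def)
    fix z :: "real^'n" assume z: "z \<in> integer_points" "z \<noteq> 0"
    show "(1 + t) *\<^sub>R f z \<notin> U"
    proof
      assume "(1 + t) *\<^sub>R f z \<in> U"
      then have "(1 + t) *\<^sub>R f z - (t / (1 + t)) *\<^sub>R ((1 + t) *\<^sub>R f z - 0) \<in> interior U"
        using zero_in_interior_symmetric_convex_body[OF U] t
        by (intro mem_interior_convex_shrink[OF conv]) auto
      moreover have "(1 + t) *\<^sub>R f z - (t / (1 + t)) *\<^sub>R ((1 + t) *\<^sub>R f z - 0) = f z"
      proof -
        have "(t / (1 + t)) *\<^sub>R ((1 + t) *\<^sub>R f z - 0) = t *\<^sub>R f z"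
          using t by simp
        then show ?thesis
          by (simp only: scaleR_left_distrib scaleR_one add_diff_cancel_right')
      qed
      ultimately show False
        using avoid[OF z] by simp
    qed
  qed (use S St in auto)
qed

section \<open>Averaging over shears of the integer lattice\<close>

text \<open>Pointwise bounds on a weighted count of the sets containing \<open>x\<close> become bounds on the weighted
  sum of their measures. Averaging arguments use one direction for the points and the other for the
  parameters.\<close>

lemma weighted_measure_double_count:
  assumes "finite F" "B \<in> fmeasurable M" "\<And>z. z \<in> F \<Longrightarrow> A z \<in> fmeasurable M"
  shows sum_measure_ge: "(\<And>x. x \<in> B \<Longrightarrow> m \<le> (\<Sum>z\<in>F. a z * indicat_real (A z) x)) \<Longrightarrow>
        (\<And>z. z \<in> F \<Longrightarrow> a z \<ge> 0) \<Longrightarrow> m * measure M B \<le> (\<Sum>z\<in>F. a z * measure M (A z))"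
    and sum_measure_le: "(\<And>x. x \<in> B \<Longrightarrow> (\<Sum>z\<in>F. a z * indicat_real (A z) x) \<le> m) \<Longrightarrow>
        (\<And>z. z \<in> F \<Longrightarrow> A z \<subseteq> B) \<Longrightarrow> (\<Sum>z\<in>F. a z * measure M (A z)) \<le> m * measure M B"
proof -
  have int: "integrable M (indicat_real S)" if "S \<in> fmeasurable M" for S
    using that by (intro integrable_real_indicator) (auto simp: fmeasurable_def)
  have meas: "(LINT x|M. indicat_real S x) = measure M S" if "S \<in> fmeasurable M" for S
    using sets.sets_into_space[OF fmeasurableD[OF that]] by (simp add: Int_absorb2)
  let ?g = "\<lambda>x. \<Sum>z\<in>F. a z * indicat_real (A z) x"
  have g: "integrable M ?g" "(LINT x|M. ?g x) = (\<Sum>z\<in>F. a z * measure M (A z))"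
  proof -
    have summand: "integrable M (\<lambda>x. a z * indicat_real (A z) x)" if "z \<in> F" for z
      by (intro integrable_mult_right int assms(3) that)
    then show "integrable M ?g"
      by (rule Bochner_Integration.integrable_sum)
    have "(LINT x|M. ?g x) = (\<Sum>z\<in>F. LINT x|M. a z * indicat_real (A z) x)"
      using summand by (rule Bochner_Integration.integral_sum)
    also have "\<dots> = (\<Sum>z\<in>F. a z * measure M (A z))"
      by (intro sum.cong refl) (simp only: integral_mult_right_zero meas assms(3))
    finally show "(LINT x|M. ?g x) = (\<Sum>z\<in>F. a z * measure M (A z))" .
  qed
  have B: "integrable M (\<lambda>x. m * indicat_real B x)" "(LINT x|M. m * indicat_real B x) = m * measure M B"
    using assms int[of B] meas[of B] by auto
  show "m * measure M B \<le> (\<Sum>z\<in>F. a z * measure M (A z))"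
    if "\<And>x. x \<in> B \<Longrightarrow> m \<le> ?g x" "\<And>z. z \<in> F \<Longrightarrow> a z \<ge> 0"
  proof -
    have "m * indicat_real B x \<le> ?g x" for x
      using that by (cases "x \<in> B") (auto intro!: sum_nonneg mult_nonneg_nonneg)
    then have "(LINT x|M. m * indicat_real B x) \<le> (LINT x|M. ?g x)"
      by (intro Bochner_Integration.integral_mono B(1) g(1)) auto
    then show ?thesis
      by (simp only: B(2) g(2))
  qed
  show "(\<Sum>z\<in>F. a z * measure M (A z)) \<le> m * measure M B"
    if "\<And>x. x \<in> B \<Longrightarrow> ?g x \<le> m" "\<And>z. z \<in> F \<Longrightarrow> A z \<subseteq> B"
  proof -
    have "?g x \<le> m * indicat_real B x" for x
    proof (cases "x \<in> B")
      case False
      then have "?g x = 0"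
        using that(2) by (intro sum.neutral) (auto simp: indicator_def)
      with False show ?thesis by simp
    qed (use that in auto)
    then have "(LINT x|M. ?g x) \<le> (LINT x|M. m * indicat_real B x)"
      by (intro Bochner_Integration.integral_mono B(1) g(1)) auto
    then show ?thesis
      by (simp only: B(2) g(2))
  qed
qed

text \<open>The copies \<open>x / 2 + (t / 2) p\<close> of the slab \<open>S\<close> lie in \<open>W\<close> for \<open>0 \<le> t \<le> 1\<close> by convexity. They have
  width \<open>s\<close> in direction \<open>i\<close>, so \<open>k\<close> of them can be placed disjointly with centres \<open>2 s\<close> apart.\<close>

lemma measure_slab_le:
  fixes W S :: "(real^'n) set"
  assumes W: "compact W" "convex W" "0 \<in> W" and p: "p \<in> W"
    and S: "S \<in> lmeasurable" "S \<subseteq> W" "\<And>x. x \<in> S \<Longrightarrow> \<bar>x $ i\<bar> \<le> s"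
    and s: "s > 0" "4 * s * real k \<le> p $ i"
  shows "real k * measure lebesgue S \<le> 2 ^ CARD('n) * measure lebesgue W"
proof (cases "k = 0")
  case False
  then have pi: "p $ i > 0"
    using s by (smt (verit) mult_pos_pos of_nat_0_less_iff bot_nat_0.not_eq_extremum)
  define T where "T j = (\<lambda>x. (1/2) *\<^sub>R x + (2 * s * real j / p $ i) *\<^sub>R p) ` S" for j :: nat
  have lm: "T j \<in> lmeasurable" and mT: "measure lebesgue (T j) = (1/2) ^ CARD('n) * measure lebesgue S" for j
  proof -
    have "(\<lambda>x. (1/2) *\<^sub>R x) ` S \<in> lmeasurable"
      using measure_linear_image_cart[OF linear_scale_self S(1)] by blast
    moreover have "T j = (+) ((2 * s * real j / p $ i) *\<^sub>R p) ` (\<lambda>x. (1/2) *\<^sub>R x) ` S"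
      unfolding T_def by (auto simp: image_image add.commute)
    ultimately show "T j \<in> lmeasurable"
      by (simp only: measurable_translation)
    show "measure lebesgue (T j) = (1/2) ^ CARD('n) * measure lebesgue S"
      unfolding T_def measure_lebesgue_affine by simp
  qed
  have "real k * ((1/2) ^ CARD('n) * measure lebesgue S) = (\<Sum>j<k. measure lebesgue (T j))"
    by (simp add: mT)
  also have "\<dots> = measure lebesgue (\<Union>j<k. T j)"
  proof (rule measure_UNION'[symmetric])
    show "pairwise (\<lambda>j j'. disjnt (T j) (T j')) {..<k}"
    proof (rule pairwiseI)
      fix j j' :: nat assume "j \<noteq> j'"
      then have far: "\<bar>real j - real j'\<bar> \<ge> 1"
        by linarith
      show "disjnt (T j) (T j')"
        unfolding disjnt_iff
      proof (intro allI notI, elim conjE)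
        fix y assume "y \<in> T j" "y \<in> T j'"
        then obtain x x' where "x \<in> S" "x' \<in> S"
          and y: "y = (1/2) *\<^sub>R x + (2 * s * real j / p $ i) *\<^sub>R p"
            "y = (1/2) *\<^sub>R x' + (2 * s * real j' / p $ i) *\<^sub>R p"
          unfolding T_def by blast
        then have xs: "\<bar>x $ i\<bar> \<le> s" "\<bar>x' $ i\<bar> \<le> s"
          using S(3) by auto
        have "y $ i = x $ i / 2 + 2 * s * real j"
          using pi by (simp add: y(1))
        moreover have "y $ i = x' $ i / 2 + 2 * s * real j'"
          using pi by (simp add: y(2))
        ultimately have "2 * s * (real j - real j') = x' $ i / 2 - x $ i / 2"
          by (simp add: algebra_simps)
        then have "\<bar>2 * s * (real j - real j')\<bar> \<le> s"
          using xs by linarith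
        moreover have "\<bar>2 * s * (real j - real j')\<bar> \<ge> 2 * s"
          using far s(1) by (simp add: abs_mult)
        ultimately show False
          using s(1) by linarith
      qed
    qed
  qed (use lm in auto)
  also have "\<dots> \<le> measure lebesgue W"
  proof (rule measure_mono_fmeasurable)
    show "(\<Union>j<k. T j) \<subseteq> W"
    proof (intro UN_least subsetI)
      fix j y assume j: "j \<in> {..<k}" and "y \<in> T j"
      then obtain x where x: "x \<in> S" and y: "y = (1/2) *\<^sub>R x + (2 * s * real j / p $ i) *\<^sub>R p"
        unfolding T_def by blast
      define c where "c = 4 * s * real j / p $ i"
      have "4 * s * real j \<le> 4 * s * real k"
        using j s(1) by simp
      then have "4 * s * real j \<le> p $ i"
        using s(2) by (rule order_trans)
      then have "0 \<le> c" "c \<le> 1"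
        using s(1) pi unfolding c_def by simp_all
      then have "c *\<^sub>R p + (1 - c) *\<^sub>R 0 \<in> W"
        by (intro convexD[OF W(2) p W(3)]) auto
      then have "c *\<^sub>R p \<in> W"
        by simp
      then have "(1/2) *\<^sub>R x + (1/2) *\<^sub>R (c *\<^sub>R p) \<in> W"
        using S(2) x by (intro convexD[OF W(2)]) auto
      moreover have "y = (1/2) *\<^sub>R x + (1/2) *\<^sub>R (c *\<^sub>R p)"
        by (simp add: y c_def)
      ultimately show "y \<in> W" by simp
    qed
    show "(\<Union>j<k. T j) \<in> sets lebesgue"
      using lm by (intro sets.finite_UN) (auto intro: fmeasurableD)
  qed (use W in \<open>simp add: lmeasurable_compact\<close>)
  finally show ?thesis
    by (simp add: power_divide field_simps)
qed simp

text \<open>The sum is \<open>(2 \<eta>)\<^sup>n\<close> times the density at \<open>x\<close> of the sheared points \<open>z + z\<^sub>i w\<close>, \<open>z \<in> F\<close>, with \<open>w\<close>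
  uniform in \<open>[-\<eta>, \<eta>]\<^sup>n\<close>. It is enough to count the \<open>z\<close> with all coordinates within \<open>r = \<eta> s / (1 + \<eta>)\<close>
  of those of \<open>x\<close>, where \<open>s = |x\<^sub>i|\<close>. This radius is chosen such that \<open>\<eta> (s - r) = r\<close>, which makes
  each such \<open>z\<close> reach \<open>x\<close>. There are at least \<open>(2 r - 1)\<^sup>n\<close> of them, each of weight at least
  \<open>1 / (s + r)\<^sup>n\<close>.\<close>

lemma lattice_density_near_point:
  fixes x :: "real^'n" and i :: 'n
  assumes eta: "0 < \<eta>" "\<eta> \<le> \<kappa> / 8" and kappa: "\<kappa> \<le> 1"
    and far: "\<bar>x $ i\<bar> * (\<eta> * \<kappa>) \<ge> 2"
    and F: "finite F" "{z \<in> integer_points. \<forall>k. \<bar>z $ k - x $ k\<bar> \<le> \<eta> * \<bar>x $ i\<bar>} \<subseteq> F"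
  shows "(2 * \<eta> * (1 - \<kappa>)) ^ CARD('n)
    \<le> (\<Sum>z\<in>F. 1 / \<bar>z $ i\<bar> ^ CARD('n) * indicat_real {y. \<forall>k. \<bar>y $ k - z $ k\<bar> \<le> \<eta> * \<bar>z $ i\<bar>} x)"
proof -
  define s where "s = \<bar>x $ i\<bar>"
  define r where "r = \<eta> * s / (1 + \<eta>)"
  define Z where "Z = {z \<in> integer_points. \<forall>k. \<bar>z $ k - x $ k\<bar> \<le> r}"
  let ?n = "CARD('n)"
  have kpos: "\<kappa> > 0" using eta by simp
  have s: "s * (\<eta> * \<kappa>) \<ge> 2" using far by (simp add: s_def)
  have spos: "s > 0"
  proof (rule ccontr)
    assume "\<not> s > 0"
    then have "s * (\<eta> * \<kappa>) \<le> 0" using eta kpos by (intro mult_nonpos_nonneg) auto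
    with s show False by simp
  qed
  have r_eq: "r * (1 + \<eta>) = \<eta> * s"
    using eta by (simp add: r_def)
  have rpos: "r > 0" using eta spos by (simp add: r_def)
  have r_le: "r \<le> \<eta> * s"
    using r_eq mult_pos_pos[OF rpos eta(1)] by (simp add: distrib_left)
  have "s * \<eta> \<ge> s * (\<eta> * \<kappa>)"
    using spos eta kappa by (intro mult_left_mono) (auto simp: mult_le_cancel_left1)
  then have "r * (1 + \<eta>) \<ge> 2"
    using s r_eq by (simp add: mult.commute)
  moreover have "r * (1 + \<eta>) \<le> r * 2"
    using rpos eta kappa by (intro mult_left_mono) auto
  ultimately have r1: "r \<ge> 1" by simp
  \<comment> \<open>Multiply by \<open>1 + \<eta>\<close>; the slack \<open>\<eta> \<kappa> s \<ge> 2\<close> absorbs the rounding error \<open>1\<close> in \<open>2 r - 1\<close>.\<close>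
  have key: "2 * \<eta> * (1 - \<kappa>) * (s + r) \<le> 2 * r - 1"
  proof -
    have "(1 - \<kappa>) * (1 + 2 * \<eta>) \<le> (1 - \<kappa>) * (1 + \<kappa> / 4)"
      using eta kappa by (intro mult_left_mono) auto
    also have "\<dots> \<le> 1 - \<kappa> / 2"
      using kpos by (simp add: algebra_simps)
    finally have "2 * \<eta> * s * ((1 - \<kappa>) * (1 + 2 * \<eta>)) \<le> 2 * \<eta> * s * (1 - \<kappa> / 2)"
      using eta spos by (intro mult_left_mono) auto
    also have "\<dots> \<le> 2 * (\<eta> * s) - (1 + \<eta>)"
      using s eta kappa by (simp add: algebra_simps)
    finally have "2 * \<eta> * (1 - \<kappa>) * (s * (1 + \<eta>) + \<eta> * s) \<le> 2 * (\<eta> * s) - (1 + \<eta>)"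
      by (simp add: algebra_simps)
    then have "2 * \<eta> * (1 - \<kappa>) * (s + r) * (1 + \<eta>) \<le> (2 * r - 1) * (1 + \<eta>)"
      unfolding r_eq[symmetric] by (simp add: algebra_simps)
    then show ?thesis
      using eta by (simp add: mult_le_cancel_right)
  qed
  have summand: "1 / (s + r) ^ ?n \<le> 1 / \<bar>z $ i\<bar> ^ ?n * indicat_real {y. \<forall>k. \<bar>y $ k - z $ k\<bar> \<le> \<eta> * \<bar>z $ i\<bar>} x"
    if "z \<in> Z" for z
  proof -
    have zr: "\<bar>z $ k - x $ k\<bar> \<le> r" for k
      using that by (simp add: Z_def)
    have lo: "s - r \<le> \<bar>z $ i\<bar>" and hi: "\<bar>z $ i\<bar> \<le> s + r"
      using zr[of i] unfolding s_def by linarith+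
    have "(s - r) * (1 + \<eta>) = s"
      using r_eq by (simp add: algebra_simps)
    then have "s - r > 0" "\<eta> * (s - r) = r"
      using spos eta r_eq by (smt (verit) zero_less_mult_pos2, simp add: algebra_simps)
    moreover have "\<eta> * (s - r) \<le> \<eta> * \<bar>z $ i\<bar>"
      using lo eta by (intro mult_left_mono) auto
    ultimately have "r \<le> \<eta> * \<bar>z $ i\<bar>" and zpos: "\<bar>z $ i\<bar> > 0"
      using lo by auto
    then have "\<bar>x $ k - z $ k\<bar> \<le> \<eta> * \<bar>z $ i\<bar>" for k
      using zr[of k] by (simp add: abs_minus_commute)
    moreover have "1 / (s + r) ^ ?n \<le> 1 / \<bar>z $ i\<bar> ^ ?n"
      using hi zpos by (intro divide_left_mono power_mono) auto
    ultimately show ?thesis by simp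
  qed
  have "2 * \<eta> * (1 - \<kappa>) \<le> (2 * r - 1) / (s + r)"
    using key spos rpos by (simp add: pos_le_divide_eq)
  then have "(2 * \<eta> * (1 - \<kappa>)) ^ ?n \<le> ((2 * r - 1) / (s + r)) ^ ?n"
    using eta kappa by (intro power_mono) auto
  also have "\<dots> = (2 * r - 1) ^ ?n * (1 / (s + r) ^ ?n)"
    by (simp add: power_divide)
  also have "\<dots> \<le> card Z * (1 / (s + r) ^ ?n)"
    unfolding Z_def using r1 spos rpos by (intro mult_right_mono card_integer_points_near_ge) auto
  also have "\<dots> = (\<Sum>z\<in>Z. 1 / (s + r) ^ ?n)"
    by simp
  also have "\<dots> \<le> (\<Sum>z\<in>Z. 1 / \<bar>z $ i\<bar> ^ ?n * indicat_real {y. \<forall>k. \<bar>y $ k - z $ k\<bar> \<le> \<eta> * \<bar>z $ i\<bar>} x)"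
    by (intro sum_mono summand)
  also have "\<dots> \<le> (\<Sum>z\<in>F. 1 / \<bar>z $ i\<bar> ^ ?n * indicat_real {y. \<forall>k. \<bar>y $ k - z $ k\<bar> \<le> \<eta> * \<bar>z $ i\<bar>} x)"
  proof (intro sum_mono2 F(1))
    show "Z \<subseteq> F"
      using order_trans[OF _ r_le] F(2) unfolding Z_def s_def by blast
  qed simp
  finally show ?thesis .
qed

lemma sup_norm_maximal_point:
  fixes W :: "(real^'n) set"
  assumes "compact W" "W \<noteq> {}" "W = uminus ` W"
  obtains p i where "p \<in> W" "\<forall>x\<in>W. \<forall>k. \<bar>x $ k\<bar> \<le> p $ i"
proof -
  have "\<exists>p\<in>W. \<forall>x\<in>W. \<bar>x $ k\<bar> \<le> \<bar>p $ k\<bar>" for k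
    using assms(1,2) by (intro continuous_attains_sup continuous_intros)
  then obtain q where q: "\<And>k. q k \<in> W" "\<And>k x. x \<in> W \<Longrightarrow> \<bar>x $ k\<bar> \<le> \<bar>q k $ k\<bar>"
    by metis
  have "Max (range (\<lambda>k. \<bar>q k $ k\<bar>)) \<in> range (\<lambda>k. \<bar>q k $ k\<bar>)"
    by (intro Max_in) auto
  then obtain i where i: "Max (range (\<lambda>k. \<bar>q k $ k\<bar>)) = \<bar>q i $ i\<bar>"
    by (rule rangeE)
  have "\<bar>q k $ k\<bar> \<le> \<bar>q i $ i\<bar>" for k
    unfolding i[symmetric] by (intro Max_ge) auto
  then have max: "\<bar>x $ k\<bar> \<le> \<bar>q i $ i\<bar>" if "x \<in> W" for x k
    using q(2)[OF that, of k] by (rule order_trans[rotated])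
  show ?thesis
  proof (cases "q i $ i \<ge> 0")
    case True
    then show ?thesis
      using that[of "q i" i] q(1) max by simp
  next
    case False
    have "- q i \<in> W"
      using assms(3) q(1)[of i] by blast
    then show ?thesis
      using that[of "- q i" i] False max by simp
  qed
qed

lemma measure_le_sup_norm:
  fixes W :: "(real^'n) set"
  assumes "compact W" "\<And>x k. x \<in> W \<Longrightarrow> \<bar>x $ k\<bar> \<le> R" "R \<ge> 0"
  shows "measure lebesgue W \<le> (2 * R) ^ CARD('n)"
proof -
  let ?C = "cbox (\<chi> k. - R) (\<chi> k. R) :: (real^'n) set"
  have "W \<subseteq> ?C"
    using assms(2) by (force simp: mem_box_cart abs_le_iff minus_le_iff)
  then have "measure lebesgue W \<le> measure lebesgue ?C"
    using assms(1) by (intro measure_mono_fmeasurable) (auto intro: fmeasurableD lmeasurable_compact)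
  also have "\<dots> = (2 * R) ^ CARD('n)"
    using assms(3) by (simp add: content_cbox_if_cart interval_eq_empty_cart)
  finally show ?thesis .
qed

text \<open>For fixed \<open>z\<close>, the set \<open>A z\<close> of shear vectors moving \<open>z\<close> into \<open>W\<close> is a copy of \<open>W\<close> intersected with
  the cube of half-side \<open>\<eta> |z\<^sub>i|\<close> at \<open>z\<close>, scaled by \<open>1 / z\<^sub>i\<close>. Summing the measures of these sets
  over \<open>z\<close> bounds the average number of sheared points in \<open>W\<close> from below by the density on \<open>X\<close>.\<close>

lemma exists_shear_many_points:
  fixes W X :: "(real^'n) set" and i :: 'n
  assumes eta: "0 < \<eta>" "\<eta> \<le> \<kappa> / 8" and kappa: "\<kappa> \<le> 1"
    and W: "open W" "bounded W"
    and X: "X \<in> lmeasurable" "X \<subseteq> W" "\<And>x. x \<in> X \<Longrightarrow> \<bar>x $ i\<bar> * (\<eta> * \<kappa>) \<ge> 2"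
    and c: "c < (1 - \<kappa>) ^ CARD('n) * measure lebesgue X"
  obtains w S where "\<And>k. \<bar>w $ k\<bar> \<le> \<eta>" "finite S" "S \<subseteq> integer_points"
    "\<And>z. z \<in> S \<Longrightarrow> z + (z $ i) *\<^sub>R w \<in> W" "c < real (card S)"
proof -
  let ?n = "CARD('n)"
  let ?Q = "cbox (\<chi> k. - \<eta>) (\<chi> k. \<eta>) :: (real^'n) set"
  let ?N = "\<lambda>z. {y. \<forall>k. \<bar>y $ k - z $ k\<bar> \<le> \<eta> * \<bar>z $ i\<bar>} :: (real^'n) set"
  obtain b where b: "\<And>x. x \<in> W \<Longrightarrow> norm x \<le> b"
    using W(2) bounded_iff by blast
  obtain L where L: "2 * b \<le> real L"
    using real_arch_simple by blast
  \<comment> \<open>Finitely many \<open>z\<close> suffice: every \<open>z\<close> that contributes near \<open>x \<in> W\<close> has \<open>|z\<^sub>k| \<le> 2 b\<close>.\<close>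
  define F where "F = {z \<in> integer_box L :: (real^'n) set. z $ i \<noteq> 0}"
  have finF: "finite F"
    unfolding F_def by (rule finite_subset[OF _ finite_integer_box[of L]]) auto
  define A where "A z = {w \<in> ?Q. z + (z $ i) *\<^sub>R w \<in> W}" for z
  have image_A: "(\<lambda>w. (z $ i) *\<^sub>R w + z) ` A z = W \<inter> ?N z" if "z \<in> F" for z
  proof (intro subset_antisym subsetI)
    fix y assume "y \<in> (\<lambda>w. (z $ i) *\<^sub>R w + z) ` A z"
    then obtain w where w: "w \<in> ?Q" "z + (z $ i) *\<^sub>R w \<in> W" and y: "y = (z $ i) *\<^sub>R w + z"
      by (auto simp: A_def)
    have "\<bar>w $ k\<bar> \<le> \<eta>" for k
      using w(1) by (auto simp: mem_box_cart abs_le_iff minus_le_iff)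
    then have "\<bar>y $ k - z $ k\<bar> \<le> \<eta> * \<bar>z $ i\<bar>" for k
      by (simp add: y abs_mult mult.commute mult_right_mono)
    with w(2) y show "y \<in> W \<inter> ?N z"
      by (simp add: add.commute)
  next
    fix y assume y: "y \<in> W \<inter> ?N z"
    have z: "z $ i \<noteq> 0"
      using that by (simp add: F_def)
    define w where "w = (1 / z $ i) *\<^sub>R (y - z)"
    have yw: "y = (z $ i) *\<^sub>R w + z"
      using z by (simp add: w_def)
    have "\<bar>w $ k\<bar> \<le> \<eta>" for k
    proof -
      have "\<bar>w $ k\<bar> * \<bar>z $ i\<bar> = \<bar>y $ k - z $ k\<bar>"
        by (simp add: yw abs_mult)
      also have "\<dots> \<le> \<eta> * \<bar>z $ i\<bar>"
        using y by simp
      finally show ?thesis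
        using z by simp
    qed
    then have "w \<in> ?Q"
      by (simp add: mem_box_cart abs_le_iff minus_le_iff)
    moreover have "z + (z $ i) *\<^sub>R w \<in> W"
      using y yw by (simp add: add.commute)
    ultimately show "y \<in> (\<lambda>w. (z $ i) *\<^sub>R w + z) ` A z"
      unfolding A_def using yw by blast
  qed
  have lmN: "W \<inter> ?N z \<in> lmeasurable" for z
  proof -
    have "?N z = cbox (z - (\<chi> k. \<eta> * \<bar>z $ i\<bar>)) (z + (\<chi> k. \<eta> * \<bar>z $ i\<bar>))"
      by (auto simp: mem_box_cart abs_diff_le_iff)
    then show ?thesis
      by (simp only: fmeasurable.Int lmeasurable_open W lmeasurable_cbox)
  qed
  have lmA: "A z \<in> lmeasurable" for z
  proof -
    have "A z = ?Q \<inter> (\<lambda>w. z + (z $ i) *\<^sub>R w) -` W"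
      by (auto simp: A_def)
    moreover have "open ((\<lambda>w. z + (z $ i) *\<^sub>R w) -` W)"
      using W(1) by (intro open_vimage continuous_intros)
    ultimately have "A z \<in> sets lebesgue"
      by (auto intro!: sets.Int borel_open sets_completionI_sets)
    then show ?thesis
      by (rule fmeasurableI2[OF lmeasurable_cbox, rotated]) (auto simp: A_def)
  qed
  have measA: "measure lebesgue (A z) = 1 / \<bar>z $ i\<bar> ^ ?n * measure lebesgue (W \<inter> ?N z)" if "z \<in> F" for z
    using that unfolding image_A[OF that, symmetric] measure_lebesgue_affine
    by (simp add: F_def)
  have "(2 * \<eta> * (1 - \<kappa>)) ^ ?n * measure lebesgue X
      \<le> (\<Sum>z\<in>F. 1 / \<bar>z $ i\<bar> ^ ?n * measure lebesgue (W \<inter> ?N z))"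
  proof (rule sum_measure_ge[OF finF X(1)])
    fix x assume x: "x \<in> X"
    have sub: "{z \<in> integer_points. \<forall>k. \<bar>z $ k - x $ k\<bar> \<le> \<eta> * \<bar>x $ i\<bar>} \<subseteq> F"
    proof clarify
      fix z assume z: "z \<in> integer_points" "\<forall>k. \<bar>z $ k - x $ k\<bar> \<le> \<eta> * \<bar>x $ i\<bar>"
      have xk: "\<bar>x $ k\<bar> \<le> b" for k
        using b[of x] x X(2) component_le_norm_cart[of x k] by auto
      have "0 < \<bar>x $ i\<bar>"
        using X(3)[OF x] by (cases "x $ i = 0") auto
      moreover have "\<eta> * \<bar>x $ i\<bar> \<le> (1/2) * \<bar>x $ i\<bar>"
        using eta kappa by (intro mult_right_mono) auto
      moreover have zi: "\<bar>z $ k - x $ k\<bar> \<le> \<eta> * \<bar>x $ i\<bar>" for k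
        using z(2) by blast
      ultimately have "\<bar>z $ i\<bar> > 0" and "\<bar>z $ k\<bar> \<le> real L" for k
        using zi[of i] zi[of k] xk[of k] xk[of i] L by linarith+
      with z(1) show "z \<in> F"
        by (simp add: F_def integer_box_def)
    qed
    have "(2 * \<eta> * (1 - \<kappa>)) ^ ?n \<le> (\<Sum>z\<in>F. 1 / \<bar>z $ i\<bar> ^ ?n * indicat_real (?N z) x)"
      by (rule lattice_density_near_point[OF eta kappa X(3)[OF x] finF sub])
    also have "\<dots> = (\<Sum>z\<in>F. 1 / \<bar>z $ i\<bar> ^ ?n * indicat_real (W \<inter> ?N z) x)"
      using x X(2) by (intro sum.cong refl) (auto simp: indicator_def)
    finally show "(2 * \<eta> * (1 - \<kappa>)) ^ ?n \<le> (\<Sum>z\<in>F. 1 / \<bar>z $ i\<bar> ^ ?n * indicat_real (W \<inter> ?N z) x)" .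
  qed (use lmN in auto)
  also have "\<dots> = (\<Sum>z\<in>F. 1 * measure lebesgue (A z))"
    using measA by (intro sum.cong) auto
  finally have lower: "(2 * \<eta> * (1 - \<kappa>)) ^ ?n * measure lebesgue X \<le> (\<Sum>z\<in>F. 1 * measure lebesgue (A z))" .
  have "\<exists>w\<in>?Q. c < real (card {z \<in> F. z + (z $ i) *\<^sub>R w \<in> W})"
  proof (rule ccontr)
    assume none: "\<not> ?thesis"
    have "(\<Sum>z\<in>F. 1 * measure lebesgue (A z)) \<le> c * measure lebesgue ?Q"
    proof (rule sum_measure_le[OF finF])
      fix w assume w: "w \<in> ?Q"
      have "(\<Sum>z\<in>F. 1 * indicat_real (A z) w) = (\<Sum>z\<in>F. if z + (z $ i) *\<^sub>R w \<in> W then 1 else 0)"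
        using w by (intro sum.cong) (auto simp: A_def indicator_def)
      also have "\<dots> = card {z \<in> F. z + (z $ i) *\<^sub>R w \<in> W}"
        using finF by (simp flip: sum.inter_filter)
      also have "\<dots> \<le> c"
        using none w by (auto simp: not_less)
      finally show "(\<Sum>z\<in>F. 1 * indicat_real (A z) w) \<le> c" .
    qed (use lmA in \<open>auto simp: A_def\<close>)
    also have "measure lebesgue ?Q = (2 * \<eta>) ^ ?n"
      using eta by (simp add: content_cbox_if_cart interval_eq_empty_cart)
    finally have upper: "(\<Sum>z\<in>F. 1 * measure lebesgue (A z)) \<le> c * (2 * \<eta>) ^ ?n" .
    have "(1 - \<kappa>) ^ ?n * measure lebesgue X * (2 * \<eta>) ^ ?n = (2 * \<eta> * (1 - \<kappa>)) ^ ?n * measure lebesgue X"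
      unfolding power_mult_distrib[of "2 * \<eta>" "1 - \<kappa>"] by (simp only: mult_ac)
    also have "\<dots> \<le> c * (2 * \<eta>) ^ ?n"
      using lower upper by (rule order_trans)
    finally have "(1 - \<kappa>) ^ ?n * measure lebesgue X \<le> c"
      using eta(1) by simp
    with c show False by simp
  qed
  then obtain w where w: "w \<in> ?Q" "c < real (card {z \<in> F. z + (z $ i) *\<^sub>R w \<in> W})"
    by blast
  show ?thesis
  proof (rule that[of w "{z \<in> F. z + (z $ i) *\<^sub>R w \<in> W}"])
    show "\<bar>w $ k\<bar> \<le> \<eta>" for k
      using w(1) by (auto simp: mem_box_cart abs_le_iff minus_le_iff)
    show "finite {z \<in> F. z + (z $ i) *\<^sub>R w \<in> W}"
      using finF by simp
  qed (use w in \<open>auto simp: F_def integer_box_def\<close>)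
qed

text \<open>The largest coordinate \<open>p\<^sub>i\<close> in \<open>W\<close> satisfies \<open>|W| \<le> (2 p\<^sub>i)\<^sup>n\<close>, hence large volume forces \<open>W\<close> to
  be long in direction \<open>i\<close>. Then the slab \<open>Y\<close> has measure at most \<open>\<delta> / 2\<close> of the whole. Off the slab
  the density of sheared points is at least \<open>(1 - \<kappa>)\<^sup>n \<ge> 1 - \<delta> / 2\<close>, and
  \<open>(1 - \<delta> / 2)\<^sup>2 > 1 - \<delta>\<close>.\<close>

theorem sheared_integer_points_in_large_body:
  fixes \<eta> \<delta> :: real
  assumes "\<eta> > 0" "0 < \<delta>" "\<delta> < 1"
  obtains T where "T > 0"
    "\<And>W :: (real^'n) set. symmetric_convex_body W \<Longrightarrow> measure lebesgue W \<ge> T \<Longrightarrow>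
       \<exists>i w S. (\<forall>k. \<bar>w $ k\<bar> \<le> \<eta>) \<and> finite S \<and> S \<subseteq> integer_points \<and>
         (\<forall>z\<in>S. z + (z $ i) *\<^sub>R w \<in> interior W) \<and> (1 - \<delta>) * measure lebesgue W \<le> real (card S)"
proof -
  let ?n = "CARD('n)"
  define \<kappa> where "\<kappa> = \<delta> / (2 * ?n)"
  define \<theta> where "\<theta> = min \<eta> (\<kappa> / 8)"
  define s where "s = 2 / (\<theta> * \<kappa>)"
  obtain k :: nat where k: "2 ^ ?n * 2 / \<delta> \<le> real k"
    using real_arch_simple by blast
  have n1: "real ?n \<ge> 1"
    by (simp add: Suc_leI)
  have "\<delta> \<le> 2 * real ?n"
    using assms n1 by linarith
  then have kappa: "0 < \<kappa>" "\<kappa> \<le> 1"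
    using assms by (auto simp: \<kappa>_def)
  have theta: "0 < \<theta>" "\<theta> \<le> \<kappa> / 8" "\<theta> \<le> \<eta>"
    using assms kappa by (auto simp: \<theta>_def)
  have s: "s > 0" "s * (\<theta> * \<kappa>) = 2"
    using theta kappa by (auto simp: s_def)
  have "0 < 2 ^ ?n * 2 / \<delta>"
    using assms by simp
  then have kpos: "real k > 0"
    using k by linarith
  show ?thesis
  proof (rule that[of "(8 * s * real k) ^ ?n"])
    show "(8 * s * real k) ^ ?n > 0"
      using s kpos by simp
    fix W :: "(real^'n) set"
    assume W: "symmetric_convex_body W" and big: "measure lebesgue W \<ge> (8 * s * real k) ^ ?n"
    have comp: "compact W" and conv: "convex W" and sym: "W = uminus ` W" and body: "convex_body W"
      using W by (auto simp: symmetric_convex_body_def convex_body_def)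
    have zero: "0 \<in> interior W"
      by (rule zero_in_interior_symmetric_convex_body[OF W])
    then have zeroW: "0 \<in> W"
      using interior_subset by blast
    then have ne: "W \<noteq> {}"
      by blast
    obtain p i where p: "p \<in> W" and "\<forall>x\<in>W. \<forall>k. \<bar>x $ k\<bar> \<le> p $ i"
      by (rule sup_norm_maximal_point[OF comp ne sym])
    then have max: "\<bar>x $ k\<bar> \<le> p $ i" if "x \<in> W" for x k
      using that by blast
    have R0: "p $ i \<ge> 0"
      using max[OF zeroW] by simp
    have "(8 * s * real k) ^ ?n \<le> (2 * p $ i) ^ ?n"
      by (rule order_trans[OF big measure_le_sup_norm[OF comp max R0]])
    moreover have "(2 * p $ i) ^ ?n < (8 * s * real k) ^ ?n" if "2 * p $ i < 8 * s * real k"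
      using that R0 by (intro power_strict_mono) simp_all
    ultimately have "8 * s * real k \<le> 2 * p $ i"
      by (meson not_le)
    then have long: "4 * s * real k \<le> p $ i"
      by simp
    define m where "m = measure lebesgue W"
    have mpos: "m > 0"
      unfolding m_def by (rule measure_convex_body_pos[OF body])
    have bnd: "bounded W"
      using comp by (rule compact_imp_bounded)
    have lmW: "interior W \<in> lmeasurable"
      using bnd by (rule lmeasurable_interior)
    have mint: "measure lebesgue (interior W) = m"
      unfolding m_def using measure_interior[OF bnd negligible_convex_frontier[OF conv]] .
    define Y where "Y = interior W \<inter> {x. \<bar>x $ i\<bar> \<le> s}"
    define X where "X = interior W - Y"
    have "closed {x :: real^'n. \<bar>x $ i\<bar> \<le> s}"
      by (intro closed_Collect_le continuous_intros)
    then have lmY: "Y \<in> lmeasurable"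
      unfolding Y_def using lmW by (intro fmeasurable_Int_fmeasurable) auto
    have "real k * measure lebesgue Y \<le> 2 ^ ?n * m"
      unfolding m_def using lmY interior_subset
      by (intro measure_slab_le[OF comp conv zeroW p _ _ _ s(1) long]) (auto simp: Y_def)
    moreover have "2 ^ ?n * 2 / \<delta> * measure lebesgue Y \<le> real k * measure lebesgue Y"
      using k by (intro mult_right_mono) auto
    ultimately have "2 ^ ?n * 2 / \<delta> * measure lebesgue Y \<le> 2 ^ ?n * m"
      by linarith
    then have slab: "measure lebesgue Y \<le> \<delta> / 2 * m"
      using assms by (simp add: field_simps)
    have lmX: "X \<in> lmeasurable"
      unfolding X_def using lmW lmY by (rule fmeasurable_Diff[OF _ fmeasurableD])
    have "measure lebesgue X = m - measure lebesgue Y"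
      unfolding X_def using lmW lmY mint
      by (subst measurable_measure_Diff) (auto simp: Y_def fmeasurableD)
    then have mX: "measure lebesgue X \<ge> (1 - \<delta> / 2) * m"
      using slab by (simp add: algebra_simps)
    have "1 - \<delta> / 2 = 1 + real ?n * (- \<kappa>)"
      using n1 by (simp add: \<kappa>_def)
    also have "\<dots> \<le> (1 + - \<kappa>) ^ ?n"
      using kappa by (intro Bernoulli_inequality) auto
    finally have pow: "1 - \<delta> / 2 \<le> (1 - \<kappa>) ^ ?n"
      by simp
    have "1 - \<delta> < (1 - \<delta> / 2) * (1 - \<delta> / 2)"
      using assms by (simp add: algebra_simps)
    then have "(1 - \<delta>) * m < (1 - \<delta> / 2) * (1 - \<delta> / 2) * m"
      using mpos by (rule mult_strict_right_mono)
    also have "\<dots> \<le> (1 - \<kappa>) ^ ?n * measure lebesgue X"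
      unfolding mult.assoc using pow mX assms mpos kappa by (intro mult_mono) auto
    finally have c: "(1 - \<delta>) * m < (1 - \<kappa>) ^ ?n * measure lebesgue X" .
    have far: "2 \<le> \<bar>x $ i\<bar> * (\<theta> * \<kappa>)" if "x \<in> X" for x
    proof -
      have "s \<le> \<bar>x $ i\<bar>"
        using that by (auto simp: X_def Y_def)
      then have "s * (\<theta> * \<kappa>) \<le> \<bar>x $ i\<bar> * (\<theta> * \<kappa>)"
        using theta kappa by (intro mult_right_mono) auto
      then show ?thesis
        by (simp only: s(2))
    qed
    obtain w S where w: "\<And>k. \<bar>w $ k\<bar> \<le> \<theta>" "finite S" "S \<subseteq> integer_points"
        "\<And>z. z \<in> S \<Longrightarrow> z + (z $ i) *\<^sub>R w \<in> interior W" "(1 - \<delta>) * m < real (card S)"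
      by (rule exists_shear_many_points[OF theta(1,2) kappa(2) open_interior bounded_interior[OF bnd] lmX _ far c])
        (auto simp: X_def)
    have "\<bar>w $ k\<bar> \<le> \<eta>" for k
      using w(1)[of k] theta(3) by (rule order_trans)
    then show "\<exists>i w S. (\<forall>k. \<bar>w $ k\<bar> \<le> \<eta>) \<and> finite S \<and> S \<subseteq> integer_points \<and>
         (\<forall>z\<in>S. z + (z $ i) *\<^sub>R w \<in> interior W) \<and> (1 - \<delta>) * measure lebesgue W \<le> real (card S)"
      using w(2-) by (intro exI[of _ i] exI[of _ w] exI[of _ S]) (auto simp: m_def)
  qed
qed

section \<open>Packing lattices in lattice coordinates\<close>

lemma lattice_of_eq: "lattice_of M = (*v) M ` integer_points"
  by (simp add: lattice_of_def integer_points_def)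

lemma inj_matrix_of_det:
  fixes M :: "real^'n^'n"
  assumes "det M \<noteq> 0"
  shows "inj ((*v) M)"
  using det_nz_iff_inj[OF matrix_vector_mul_linear[of M]] assms by simp

lemma lattice_packing_half_iff:
  fixes U :: "(real^'n) set" and M :: "real^'n^'n"
  assumes "inj ((*v) M)"
  shows "lattice_packing ((\<lambda>x. (1 / 2) *\<^sub>R x) ` U) (lattice_of M)
    \<longleftrightarrow> (\<forall>z\<in>integer_points. z \<noteq> 0 \<longrightarrow> M *v z \<notin> interior U)"
proof -
  have U: "(\<lambda>x. 2 *\<^sub>R x) ` (\<lambda>x. (1 / 2) *\<^sub>R x) ` U = U"
    by (simp add: image_image)
  show ?thesis
    unfolding lattice_packing_def lattice_of_eq U
  proof (intro iffI ballI impI)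
    fix z :: "real^'n"
    assume pack: "\<forall>a\<in>(*v) M ` integer_points. \<forall>b\<in>(*v) M ` integer_points. a \<noteq> b \<longrightarrow> a - b \<notin> interior U"
      and z: "z \<in> integer_points" "z \<noteq> 0"
    have "M *v z \<noteq> M *v 0"
      using inj_eq[OF assms] z(2) by blast
    then have "M *v z - M *v 0 \<notin> interior U"
      using pack z(1) zero_integer_point by blast
    then show "M *v z \<notin> interior U"
      by simp
  next
    fix a b
    assume avoid: "\<forall>z\<in>integer_points. z \<noteq> 0 \<longrightarrow> M *v z \<notin> interior U"
      and "a \<in> (*v) M ` integer_points" "b \<in> (*v) M ` integer_points" "a \<noteq> b"
    then obtain x y where xy: "x \<in> integer_points" "y \<in> integer_points" "a = M *v x" "b = M *v y" "x \<noteq> y"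
      by blast
    then have "M *v (x - y) \<notin> interior U"
      using avoid integer_points_diff[OF xy(1,2)] by simp
    then show "a - b \<notin> interior U"
      by (simp add: xy matrix_vector_mult_diff_distrib)
  qed
qed

lemma wiener_const_ge_packing_lattice:
  fixes U V L :: "(real^'n) set"
  assumes U: "symmetric_convex_body U" and V: "symmetric_convex_body V"
    and L: "full_rank_lattice L" "lattice_packing ((\<lambda>x. (1 / 2) *\<^sub>R x) ` U) L"
  shows "wiener_const U V \<ge> ereal (real (card (L \<inter> interior V)) * measure lebesgue U / measure lebesgue V)"
proof -
  obtain M :: "real^'n^'n" where M: "det M \<noteq> 0" "L = lattice_of M"
    using L(1) by (auto simp: full_rank_lattice_def)
  note inj = inj_matrix_of_det[OF M(1)]
  have bnd: "bounded (interior V)"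
    using V by (auto simp: symmetric_convex_body_def convex_body_def intro: bounded_interior compact_imp_bounded)
  define S where "S = {z \<in> integer_points. M *v z \<in> interior V}"
  have "L \<inter> interior V = (*v) M ` S"
    unfolding M(2) lattice_of_eq S_def by blast
  then have "card (L \<inter> interior V) = card S"
    using inj by (simp add: card_image inj_on_subset[OF inj])
  moreover have "ereal (real (card S) * (measure lebesgue U / measure lebesgue V)) \<le> wiener_const U V"
  proof (rule wiener_const_ge_lattice[OF U V matrix_vector_mul_linear inj])
    show "finite S"
      unfolding S_def by (rule finite_lattice_points_bounded[OF matrix_vector_mul_linear inj bnd])
    show "M *v z \<notin> interior U" if "z \<in> integer_points" "z \<noteq> 0" for z
      using L(2) that lattice_packing_half_iff[OF inj] M(2) by blast
  qed (auto simp: S_def)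
  ultimately show ?thesis
    by simp
qed

lemma symmetric_convex_body_linear_image:
  fixes g :: "real^'n \<Rightarrow> real^'n"
  assumes A: "symmetric_convex_body A" and g: "linear g" "inj g"
  shows "symmetric_convex_body (g ` A)"
  unfolding symmetric_convex_body_def convex_body_def
proof (intro conjI)
  have body: "compact A" "convex A" "interior A \<noteq> {}" and sym: "A = uminus ` A"
    using A by (auto simp: symmetric_convex_body_def convex_body_def)
  show "compact (g ` A)"
    using g(1) body(1) by (intro compact_continuous_image linear_continuous_on)
      (auto simp: linear_conv_bounded_linear)
  show "convex (g ` A)"
    by (rule convex_linear_image[OF g(1) body(2)])
  show "interior (g ` A) \<noteq> {}"
    using body(3) by (simp add: interior_injective_linear_image[OF g])
  have "uminus ` g ` A = g ` uminus ` A"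
    by (auto simp: image_image linear_neg[OF g(1)])
  then show "g ` A = uminus ` g ` A"
    using sym by simp
qed

text \<open>The inverse of \<open>M\<close> as a function: it turns the lattice into the integer lattice and the body
  \<open>V\<close> into a body of volume \<open>|V| / |det M|\<close>.\<close>

lemma lattice_coordinates:
  fixes M :: "real^'n^'n"
  assumes "det M \<noteq> 0"
  obtains g where "linear g" "inj g" "\<And>x. M *v g x = x" "\<And>x. g (M *v x) = x"
    "\<And>S. S \<in> lmeasurable \<Longrightarrow> measure lebesgue (g ` S) = measure lebesgue S / \<bar>det M\<bar>"
proof -
  have lin: "linear ((*v) M)"
    by (rule matrix_vector_mul_linear)
  obtain g where g: "linear g" "\<forall>x. g (M *v x) = x" "\<forall>x. M *v g x = x"
    using linear_injective_isomorphism[OF lin inj_matrix_of_det[OF assms]] by blast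
  show ?thesis
  proof (rule that[of g])
    show "inj g"
      using g(3) by (metis injI)
    fix S :: "(real^'n) set" assume "S \<in> lmeasurable"
    then have "g ` S \<in> lmeasurable"
      using measure_linear_image_cart[OF g(1)] by blast
    then have "measure lebesgue ((*v) M ` g ` S) = \<bar>det M\<bar> * measure lebesgue (g ` S)"
      using measure_linear_image_cart[OF lin] by simp
    moreover have "(*v) M ` g ` S = S"
      using g(3) by (simp add: image_image)
    ultimately show "measure lebesgue (g ` S) = measure lebesgue S / \<bar>det M\<bar>"
      using assms by simp
  qed (use g in auto)
qed

section \<open>Minkowski's bound and the packing density\<close>

lemma convex_half_difference:
  fixes W :: "(real^'n) set"
  assumes W: "symmetric_convex_body W" and "a \<in> interior W" "b \<in> interior W"
  shows "(1/2) *\<^sub>R a - (1/2) *\<^sub>R b \<in> interior W"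
proof -
  have "interior W = uminus ` interior W"
    using W interior_negations by (metis symmetric_convex_body_def)
  then have "- b \<in> interior W"
    using assms(3) by blast
  moreover have "convex (interior W)"
    using W by (auto simp: symmetric_convex_body_def convex_body_def intro: convex_interior)
  ultimately have "(1/2) *\<^sub>R a + (1/2) *\<^sub>R (- b) \<in> interior W"
    using assms(2) by (intro convexD) auto
  then show ?thesis by simp
qed

text \<open>Minkowski's convex body theorem. Cut \<open>X = W\<^sup>o / 2\<close> along the unit cubes at the integer points
  and translate the pieces into one unit cube \<open>P\<close>. A point of \<open>P\<close> in two pieces would give a nonzero
  integer point \<open>(a - a') / 2\<close> with \<open>a\<close>, \<open>a'\<close> in the interior of \<open>W\<close>. So the pieces have total
  measure at most \<open>1\<close>.\<close>

lemma minkowski_convex_body: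
  fixes W :: "(real^'n) set"
  assumes W: "symmetric_convex_body W"
    and avoid: "\<And>z. z \<in> integer_points \<Longrightarrow> z \<noteq> 0 \<Longrightarrow> z \<notin> interior W"
  shows "measure lebesgue W \<le> 2 ^ CARD('n)"
proof -
  have comp: "compact W" and conv: "convex W"
    using W by (auto simp: symmetric_convex_body_def convex_body_def)
  have bnd: "bounded W"
    using comp by (rule compact_imp_bounded)
  define X where "X = (\<lambda>x. (1/2) *\<^sub>R x) ` interior W"
  have lmX: "X \<in> lmeasurable"
    unfolding X_def
    using measure_linear_image_cart[OF linear_scale_self lmeasurable_interior[OF bnd]] by blast
  have "measure lebesgue X = (1/2) ^ CARD('n) * measure lebesgue (interior W)"
    unfolding X_def using measure_lebesgue_affine[of "1/2" "0 :: real^'n" "interior W"] by simp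
  also have "measure lebesgue (interior W) = measure lebesgue W"
    by (rule measure_interior[OF bnd negligible_convex_frontier[OF conv]])
  finally have mX: "measure lebesgue X = (1/2) ^ CARD('n) * measure lebesgue W" .
  have "bounded X"
    unfolding X_def by (intro bounded_linear_image bounded_interior bnd bounded_linear_scaleR_right)
  then obtain b where b: "\<And>x. x \<in> X \<Longrightarrow> norm x \<le> b"
    unfolding bounded_iff by blast
  obtain N where N: "b + 1 \<le> real N"
    using real_arch_simple by blast
  let ?P = "cbox 0 (\<chi> k. 1) :: (real^'n) set"
  let ?F = "integer_box N :: (real^'n) set"
  have lmXP: "X \<inter> (+) z ` ?P \<in> lmeasurable" and lmXP': "(+) (- z) ` X \<inter> ?P \<in> lmeasurable" for z
    by (intro fmeasurable.Int lmX measurable_translation lmeasurable_cbox)+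
  have "1 * measure lebesgue X \<le> (\<Sum>z\<in>?F. 1 * measure lebesgue (X \<inter> (+) z ` ?P))"
  proof (rule sum_measure_ge[OF finite_integer_box lmX])
    fix x assume x: "x \<in> X"
    define z :: "real^'n" where "z = (\<chi> k. real_of_int \<lfloor>x $ k\<rfloor>)"
    have "\<bar>x $ k\<bar> \<le> b" for k
      using b[OF x] component_le_norm_cart[of x k] by simp
    then have "\<bar>real_of_int \<lfloor>x $ k\<rfloor>\<bar> \<le> real N" for k
      using N of_int_floor_le[of "x $ k"] real_of_int_floor_add_one_gt[of "x $ k"]
      unfolding abs_le_iff by (smt (verit))
    then have "\<bar>z $ k\<bar> \<le> real N" for k
      by (simp add: z_def)
    then have zF: "z \<in> ?F"
      by (simp add: integer_box_def integer_points_def z_def)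
    have "0 \<le> x $ k - real_of_int \<lfloor>x $ k\<rfloor> \<and> x $ k - real_of_int \<lfloor>x $ k\<rfloor> \<le> 1" for k
      by linarith
    then have "x - z \<in> ?P"
      by (simp add: mem_box_cart z_def)
    then have "x \<in> X \<inter> (+) z ` ?P"
      using x by (auto intro!: image_eqI[of _ _ "x - z"])
    then have "1 = (\<Sum>z\<in>{z}. 1 * indicat_real (X \<inter> (+) z ` ?P) x)"
      by simp
    also have "\<dots> \<le> (\<Sum>z\<in>?F. 1 * indicat_real (X \<inter> (+) z ` ?P) x)"
      using zF finite_integer_box by (intro sum_mono2) auto
    finally show "1 \<le> (\<Sum>z\<in>?F. 1 * indicat_real (X \<inter> (+) z ` ?P) x)" .
  qed (use lmXP in auto)
  also have "\<dots> = (\<Sum>z\<in>?F. 1 * measure lebesgue ((+) (- z) ` X \<inter> ?P))"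
  proof (intro sum.cong refl)
    fix z
    have "X \<inter> (+) z ` ?P = (+) z ` ((+) (- z) ` X \<inter> ?P)"
      by (simp only: translation_Int image_image add_minus_cancel image_ident)
    then show "1 * measure lebesgue (X \<inter> (+) z ` ?P) = 1 * measure lebesgue ((+) (- z) ` X \<inter> ?P)"
      by (simp only: measure_translation)
  qed
  also have "\<dots> \<le> 1 * measure lebesgue ?P"
  proof (rule sum_measure_le[OF finite_integer_box])
    fix x assume "x \<in> ?P"
    define G where "G = {z \<in> ?F. x \<in> (+) (- z) ` X}"
    have "z = z'" if "z \<in> G" "z' \<in> G" for z z'
    proof (rule ccontr)
      assume "z \<noteq> z'"
      have "x \<in> (+) (- z) ` X" "x \<in> (+) (- z') ` X"
        using that by (simp_all only: G_def mem_Collect_eq)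
      then obtain a a' where a: "a \<in> interior W" "a' \<in> interior W"
        "x = - z + (1/2) *\<^sub>R a" "x = - z' + (1/2) *\<^sub>R a'"
        unfolding X_def by (elim imageE) simp
      have "z - z' = (1/2) *\<^sub>R a - (1/2) *\<^sub>R a'"
        using a(3,4) by (simp add: algebra_simps)
      then have "z - z' \<in> interior W"
        using convex_half_difference[OF W a(1,2)] by simp
      moreover have "z - z' \<in> integer_points"
        using that by (intro integer_points_diff) (auto simp: G_def integer_box_def)
      ultimately show False
        using avoid \<open>z \<noteq> z'\<close> by auto
    qed
    moreover have "finite G"
      unfolding G_def by (rule finite_subset[OF _ finite_integer_box[of N]]) auto
    ultimately have "card G \<le> 1"
      by (auto simp: card_le_Suc0_iff_eq)
    moreover have "(\<Sum>z\<in>?F. 1 * indicat_real ((+) (- z) ` X \<inter> ?P) x) = (\<Sum>z\<in>?F. if x \<in> (+) (- z) ` X then 1 else 0)"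
      using \<open>x \<in> ?P\<close> by (intro sum.cong refl) (simp add: indicator_def)
    moreover have "\<dots> = (\<Sum>z\<in>G. 1)"
      unfolding G_def by (rule sum.inter_filter[OF finite_integer_box, symmetric])
    ultimately show "(\<Sum>z\<in>?F. 1 * indicat_real ((+) (- z) ` X \<inter> ?P) x) \<le> 1"
      by simp
  qed (use lmXP' in auto)
  also have "\<dots> = 1"
    by (simp add: content_cbox_if_cart interval_eq_empty_cart)
  finally show ?thesis
    by (simp add: mX power_divide)
qed

text \<open>Without a packing lattice the supremum in \<open>lattice_packing_density\<close> would be \<open>-\<infinity>\<close>, and the
  right-hand side of the asymptotic bound would be \<open>\<infinity>\<close> for \<open>\<epsilon> > 1\<close>.\<close>

lemma exists_packing_lattice:
  fixes U :: "(real^'n) set"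
  assumes "symmetric_convex_body U"
  obtains M :: "real^'n^'n" where "det M \<noteq> 0" "lattice_packing ((\<lambda>x. (1 / 2) *\<^sub>R x) ` U) (lattice_of M)"
proof -
  have "compact U"
    using assms by (simp add: symmetric_convex_body_def convex_body_def)
  then obtain b where b: "b > 0" "\<And>x. x \<in> U \<Longrightarrow> norm x \<le> b"
    using compact_imp_bounded bounded_pos by metis
  define M :: "real^'n^'n" where "M = matrix (\<lambda>x. (2 * b) *\<^sub>R x)"
  have Mv: "M *v x = (2 * b) *\<^sub>R x" for x
    unfolding M_def by (rule matrix_works) (simp add: linear_matrix_vector_mul_eq linear_scale_self)
  have inj: "inj ((*v) M)"
    using b by (auto simp: inj_def Mv)
  then have "det M \<noteq> 0"
    using det_nz_iff_inj[OF matrix_vector_mul_linear[of M]] by simp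
  moreover have "M *v z \<notin> interior U" if z: "z \<in> integer_points" "z \<noteq> 0" for z
  proof
    assume "M *v z \<in> interior U"
    then have "norm (M *v z) \<le> b"
      using b(2) interior_subset by blast
    then have "2 * norm z \<le> 1"
      using b(1) by (simp add: Mv)
    moreover obtain k where "z $ k \<noteq> 0"
      using z(2) by (auto simp: vec_eq_iff)
    then have "1 \<le> \<bar>z $ k\<bar>"
      using z(1) by (intro Ints_nonzero_abs_ge1) (auto simp: integer_points_def)
    ultimately show False
      using component_le_norm_cart[of z k] by linarith
  qed
  ultimately show ?thesis
    using that[of M] by (simp add: lattice_packing_half_iff[OF inj])
qed

lemma packing_density_half:
  fixes U :: "(real^'n) set"
  shows "2 ^ CARD('n) * packing_density ((\<lambda>x. (1 / 2) *\<^sub>R x) ` U) M = measure lebesgue U / \<bar>det M\<bar>"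
  using measure_lebesgue_affine[of "1/2" "0 :: real^'n" U]
  by (simp add: packing_density_def power_divide)

lemma packing_density_le_1:
  fixes U :: "(real^'n) set" and M :: "real^'n^'n"
  assumes U: "symmetric_convex_body U" and M: "det M \<noteq> 0"
    and pack: "lattice_packing ((\<lambda>x. (1 / 2) *\<^sub>R x) ` U) (lattice_of M)"
  shows "packing_density ((\<lambda>x. (1 / 2) *\<^sub>R x) ` U) M \<le> 1"
proof -
  obtain g where g: "linear g" "inj g" "\<And>x. M *v g x = x" "\<And>x. g (M *v x) = x"
    "\<And>S. S \<in> lmeasurable \<Longrightarrow> measure lebesgue (g ` S) = measure lebesgue S / \<bar>det M\<bar>"
    using lattice_coordinates[OF M] by blast
  have avoid: "M *v z \<notin> interior U" if "z \<in> integer_points" "z \<noteq> 0" for z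
    using pack that unfolding lattice_packing_half_iff[OF inj_matrix_of_det[OF M]] by blast
  have lm: "U \<in> lmeasurable"
    using U by (simp add: symmetric_convex_body_def convex_body_def lmeasurable_compact)
  have "measure lebesgue (g ` U) \<le> 2 ^ CARD('n)"
  proof (rule minkowski_convex_body[OF symmetric_convex_body_linear_image[OF U g(1,2)]])
    show "z \<notin> interior (g ` U)" if "z \<in> integer_points" "z \<noteq> 0" for z
      using avoid[OF that] g(3) unfolding interior_injective_linear_image[OF g(1,2)] by auto
  qed
  then have "2 ^ CARD('n) * packing_density ((\<lambda>x. (1 / 2) *\<^sub>R x) ` U) M \<le> 2 ^ CARD('n) * 1"
    unfolding packing_density_half by (simp add: g(5)[OF lm])
  then show ?thesis
    by (rule mult_left_le_imp_le) simp
qed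

section \<open>Bodies of large volume\<close>

text \<open>If \<open>u = (1 + t) (z + z\<^sub>i w)\<close> were in \<open>W\<close>, then \<open>z\<^sub>i\<close> would be bounded in terms of \<open>W\<close>, as
  \<open>|1 + w\<^sub>i| \<ge> 1 / 2\<close>. Hence \<open>z = u / (1 + t) - z\<^sub>i w\<close> is a convex combination of \<open>u\<close> and the point
  \<open>q = - ((1 + t) / t) z\<^sub>i w\<close>, which lies near \<open>0\<close> and so in the interior of \<open>W\<close> once \<open>\<eta>\<close> is small.\<close>

lemma shear_keeps_avoiding:
  fixes W :: "(real^'n) set" and t :: real
  assumes W: "symmetric_convex_body W"
    and avoid: "\<And>z. z \<in> integer_points \<Longrightarrow> z \<noteq> 0 \<Longrightarrow> z \<notin> interior W"
    and t: "t > 0"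
  obtains \<eta> where "\<eta> > 0" "\<eta> \<le> 1/2"
    "\<And>i w z. \<forall>k. \<bar>w $ k\<bar> \<le> \<eta> \<Longrightarrow> z \<in> integer_points \<Longrightarrow> z \<noteq> 0 \<Longrightarrow>
       (1 + t) *\<^sub>R (z + (z $ i) *\<^sub>R w) \<notin> W"
proof -
  have comp: "compact W" and conv: "convex W"
    using W by (auto simp: symmetric_convex_body_def convex_body_def)
  obtain b where b: "b > 0" "\<And>x. x \<in> W \<Longrightarrow> norm x \<le> b"
    using compact_imp_bounded[OF comp] bounded_pos by metis
  have "\<forall>\<^sub>F e in at_right 0. \<forall>x. (\<forall>i. \<bar>x $ i - 0 $ i\<bar> \<le> e) \<longrightarrow> x \<in> interior W"
    by (rule eventually_small_box_subset_open[OF open_interior zero_in_interior_symmetric_convex_body[OF W]])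
  moreover have "\<forall>\<^sub>F e in at_right 0. e > (0::real)"
    by (rule eventually_at_right_less)
  ultimately have "\<forall>\<^sub>F e in at_right 0. e > 0 \<and> (\<forall>x. (\<forall>i. \<bar>x $ i - 0 $ i\<bar> \<le> e) \<longrightarrow> x \<in> interior W)"
    by eventually_elim blast
  then obtain \<rho> :: real where rho: "\<rho> > 0" "\<And>x. \<forall>i. \<bar>x $ i\<bar> \<le> \<rho> \<Longrightarrow> x \<in> interior W"
    by (force dest!: eventually_happens)
  define \<eta> where "\<eta> = min (1/2) (\<rho> * t / ((1 + t) * (2 * b)))"
  show ?thesis
  proof (rule that[of \<eta>])
    show eta: "\<eta> > 0" "\<eta> \<le> 1/2"
      unfolding \<eta>_def using rho(1) t b(1) by (simp, intro min.cobounded1)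
    have "\<eta> \<le> \<rho> * t / ((1 + t) * (2 * b))"
      by (simp add: \<eta>_def)
    then have small: "\<eta> * ((1 + t) * (2 * b)) \<le> \<rho> * t"
      using t b by (simp add: pos_le_divide_eq)
    fix i :: 'n and w z :: "real^'n"
    assume w: "\<forall>k. \<bar>w $ k\<bar> \<le> \<eta>" and z: "z \<in> integer_points" "z \<noteq> 0"
    show "(1 + t) *\<^sub>R (z + (z $ i) *\<^sub>R w) \<notin> W"
    proof
      define u where "u = (1 + t) *\<^sub>R (z + (z $ i) *\<^sub>R w)"
      assume "(1 + t) *\<^sub>R (z + (z $ i) *\<^sub>R w) \<in> W"
      then have u: "u \<in> W"
        by (simp add: u_def)
      have ui: "\<bar>u $ i\<bar> = (1 + t) * (\<bar>z $ i\<bar> * \<bar>1 + w $ i\<bar>)"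
      proof -
        have "u $ i = (1 + t) * (z $ i * (1 + w $ i))"
          by (simp add: u_def algebra_simps)
        then have "\<bar>u $ i\<bar> = \<bar>1 + t\<bar> * (\<bar>z $ i\<bar> * \<bar>1 + w $ i\<bar>)"
          by (simp only: abs_mult)
        then show ?thesis
          using t by simp
      qed
      have "\<bar>z $ i\<bar> * (1/2) \<le> \<bar>z $ i\<bar> * \<bar>1 + w $ i\<bar>"
        using w[rule_format, of i] eta by (intro mult_left_mono) auto
      also have "\<dots> \<le> (1 + t) * (\<bar>z $ i\<bar> * \<bar>1 + w $ i\<bar>)"
        using t mult_right_mono[of 1 "1 + t" "\<bar>z $ i\<bar> * \<bar>1 + w $ i\<bar>"] by simp
      also have "\<dots> \<le> b"
        using b(2)[OF u] component_le_norm_cart[of u i] ui by linarith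
      finally have zi: "\<bar>z $ i\<bar> \<le> 2 * b" by simp
      define q where "q = - ((1 + t) / t * z $ i) *\<^sub>R w"
      have "\<bar>q $ k\<bar> \<le> \<rho>" for k
      proof -
        have "\<bar>q $ k\<bar> * t = (1 + t) * (\<bar>z $ i\<bar> * \<bar>w $ k\<bar>)"
          using t by (simp add: q_def abs_mult)
        also have "\<dots> \<le> (1 + t) * (2 * b * \<eta>)"
          using zi w t b by (intro mult_left_mono mult_mono) auto
        also have "\<dots> \<le> \<rho> * t"
          using small by (simp add: mult_ac)
        finally show ?thesis
          using t by simp
      qed
      then have q: "q \<in> interior W"
        by (intro rho(2)) blast
      have "u - (t / (1 + t)) *\<^sub>R (u - q) \<in> interior W"
        using t by (intro mem_interior_convex_shrink[OF conv q u]) auto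
      moreover have "u - (t / (1 + t)) *\<^sub>R (u - q) = z"
      proof -
        have "u - (t / (1 + t)) *\<^sub>R (u - q) = (1 - t / (1 + t)) *\<^sub>R u + (t / (1 + t)) *\<^sub>R q"
          by (simp add: algebra_simps)
        also have "1 - t / (1 + t) = 1 / (1 + t)"
          using t by (simp add: field_simps)
        also have "(1 / (1 + t)) *\<^sub>R u = z + (z $ i) *\<^sub>R w"
          using t by (simp add: u_def)
        also have "(t / (1 + t)) *\<^sub>R q = - (z $ i) *\<^sub>R w"
          using t by (simp add: q_def)
        finally show ?thesis by simp
      qed
      ultimately show False
        using avoid[OF z] by simp
    qed
  qed
qed

text \<open>Two factors are lost: a factor \<open>1 - \<epsilon> / 2\<close> from counting sheared points and a factor \<open>1 / (1 + t)\<^sup>n\<close> from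
  dilating the sheared lattice so that it packs again. Here
  \<open>t = \<epsilon> / (2 n)\<close> makes the second factor at least \<open>1 - \<epsilon> / 2\<close> by Bernoulli's inequality. The shear size
  \<open>\<eta>\<close> depends on \<open>U\<close>, \<open>M\<close> and \<open>t\<close> only, so one threshold serves all \<open>V\<close>.\<close>

theorem wiener_const_ge_density_large_volume:
  fixes U :: "(real^'n) set" and M :: "real^'n^'n" and \<epsilon> :: real
  assumes U: "symmetric_convex_body U" and M: "det M \<noteq> 0"
    and avoid: "\<And>z. z \<in> integer_points \<Longrightarrow> z \<noteq> 0 \<Longrightarrow> M *v z \<notin> interior U"
    and eps: "0 < \<epsilon>" "\<epsilon> < 1"
  obtains T where "T > 0" "\<And>V. symmetric_convex_body V \<Longrightarrow> measure lebesgue V \<ge> T \<Longrightarrow>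
     wiener_const U V \<ge> ereal ((1 - \<epsilon>) * (measure lebesgue U / \<bar>det M\<bar>))"
proof -
  let ?n = "CARD('n)"
  obtain g where g: "linear g" "inj g" "\<And>x. M *v g x = x" "\<And>x. g (M *v x) = x"
    "\<And>S. S \<in> lmeasurable \<Longrightarrow> measure lebesgue (g ` S) = measure lebesgue S / \<bar>det M\<bar>"
    using lattice_coordinates[OF M] by blast
  define t where "t = \<epsilon> / (2 * ?n)"
  have t: "t > 0" "real ?n * t = \<epsilon> / 2"
    using eps by (auto simp: t_def)
  have "real ?n * t \<ge> 1 * t"
    using t(1) by (intro mult_right_mono) (auto simp: Suc_leI)
  then have t1: "t \<le> 1"
    using t(2) eps by linarith
  have "1 - \<epsilon> / 2 = 1 + real ?n * (- t)"
    using t(2) by simp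
  also have "\<dots> \<le> (1 + - t) ^ ?n"
    using t1 by (intro Bernoulli_inequality) auto
  also have "\<dots> \<le> (1 / (1 + t)) ^ ?n"
    using t t1 by (intro power_mono) (auto simp: field_simps)
  finally have shrink: "1 - \<epsilon> / 2 \<le> (1 / (1 + t)) ^ ?n" .
  have "1 - \<epsilon> \<le> (1 - \<epsilon> / 2) * (1 - \<epsilon> / 2)"
    by (simp add: algebra_simps)
  also have "\<dots> \<le> (1 - \<epsilon> / 2) * (1 / (1 + t)) ^ ?n"
    using shrink eps by (intro mult_left_mono) auto
  finally have const: "1 - \<epsilon> \<le> (1 - \<epsilon> / 2) * (1 / (1 + t)) ^ ?n" .
  have gU: "symmetric_convex_body (g ` U)"
    by (rule symmetric_convex_body_linear_image[OF U g(1,2)])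
  have "z \<notin> interior (g ` U)" if "z \<in> integer_points" "z \<noteq> 0" for z
    using avoid[OF that] g(3) unfolding interior_injective_linear_image[OF g(1,2)] by auto
  then obtain \<eta> where eta: "\<eta> > 0" "\<eta> \<le> 1/2"
    and keep: "\<And>i w z. \<forall>k. \<bar>w $ k\<bar> \<le> \<eta> \<Longrightarrow> z \<in> integer_points \<Longrightarrow> z \<noteq> 0 \<Longrightarrow>
       (1 + t) *\<^sub>R (z + (z $ i) *\<^sub>R w) \<notin> g ` U"
    using shear_keeps_avoiding[OF gU _ t(1)] by blast
  obtain T where T: "T > 0"
    "\<And>W :: (real^'n) set. symmetric_convex_body W \<Longrightarrow> measure lebesgue W \<ge> T \<Longrightarrow>
       \<exists>i w S. (\<forall>k. \<bar>w $ k\<bar> \<le> \<eta>) \<and> finite S \<and> S \<subseteq> integer_points \<and>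
         (\<forall>z\<in>S. z + (z $ i) *\<^sub>R w \<in> interior W) \<and> (1 - \<epsilon> / 2) * measure lebesgue W \<le> real (card S)"
    by (rule sheared_integer_points_in_large_body[of \<eta> "\<epsilon> / 2"]) (use eta eps in auto)
  show ?thesis
  proof (rule that[of "T * (1 + t) ^ ?n * \<bar>det M\<bar>"])
    show "T * (1 + t) ^ ?n * \<bar>det M\<bar> > 0"
      using T(1) t(1) M by simp
    fix V :: "(real^'n) set"
    assume V: "symmetric_convex_body V" and big: "measure lebesgue V \<ge> T * (1 + t) ^ ?n * \<bar>det M\<bar>"
    have body: "convex_body V"
      using V by (simp add: symmetric_convex_body_def)
    then have lmV: "V \<in> lmeasurable"
      by (simp add: convex_body_def lmeasurable_compact)
    have Vpos: "measure lebesgue V > 0"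
      by (rule measure_convex_body_pos[OF body])
    \<comment> \<open>The body in the coordinates of the dilated lattice \<open>(1 + t) M\<close>.\<close>
    define h where "h x = (1 / (1 + t)) *\<^sub>R g x" for x
    have h: "linear h" "inj h"
      using linear_compose_scale_right[OF g(1)] g(2) t(1) by (auto simp: h_def[abs_def] inj_def)
    have "h ` V = (\<lambda>x. (1 / (1 + t)) *\<^sub>R x + 0) ` g ` V"
      by (simp add: h_def image_image)
    then have mh: "measure lebesgue (h ` V) = (1 / (1 + t)) ^ ?n * (measure lebesgue V / \<bar>det M\<bar>)"
      using t(1) g(5)[OF lmV] by (simp only: measure_lebesgue_affine) simp
    have "T \<le> measure lebesgue (h ` V)"
      unfolding mh using big t(1) M by (simp add: power_divide field_simps)
    then obtain i w S where w: "\<forall>k. \<bar>w $ k\<bar> \<le> \<eta>" and S: "finite S" "S \<subseteq> integer_points"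
      "\<forall>z\<in>S. z + (z $ i) *\<^sub>R w \<in> interior (h ` V)"
      "(1 - \<epsilon> / 2) * measure lebesgue (h ` V) \<le> real (card S)"
      using T(2)[OF symmetric_convex_body_linear_image[OF V h]] by blast
    define f where "f z = M *v ((1 + t) *\<^sub>R (z + (z $ i) *\<^sub>R w))" for z
    have "linear (\<lambda>z. (1 + t) *\<^sub>R (z + (z $ i) *\<^sub>R w))"
      by (rule linearI) (auto simp: algebra_simps)
    then have linf: "linear f"
      using linear_compose[OF _ matrix_vector_mul_linear, of _ M] by (simp add: f_def[abs_def] o_def)
    have injf: "inj f"
      unfolding linear_injective_0[OF linf]
    proof (intro allI impI)
      fix z assume "f z = 0"
      then have "g (f z) = 0"
        using linear_0[OF g(1)] by simp
      then have eq: "z + (z $ i) *\<^sub>R w = 0"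
        using t(1) by (simp add: f_def g(4))
      then have "z $ i * (1 + w $ i) = 0"
      proof -
        have "(z + (z $ i) *\<^sub>R w) $ i = 0"
          by (simp only: eq zero_index)
        then show ?thesis
          by (simp add: distrib_left)
      qed
      moreover have "1 + w $ i \<noteq> 0"
        using w[rule_format, of i] eta by linarith
      ultimately show "z = 0"
        using eq by simp
    qed
    have "ereal (real (card S) * (measure lebesgue U / measure lebesgue V)) \<le> wiener_const U V"
    proof (rule wiener_const_ge_lattice[OF U V linf injf _ S(1,2)])
      fix z :: "real^'n" assume z: "z \<in> integer_points" "z \<noteq> 0"
      show "f z \<notin> interior U"
      proof
        assume "f z \<in> interior U"
        then have "g (f z) \<in> g ` U"
          using interior_subset by blast
        then show False
          using keep[OF w z] by (simp add: f_def g(4))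
      qed
    next
      show "f ` S \<subseteq> interior V"
      proof clarify
        fix z assume "z \<in> S"
        then obtain y where y: "y \<in> interior V" "z + (z $ i) *\<^sub>R w = h y"
          using S(3) unfolding interior_injective_linear_image[OF h] by blast
        have "f z = y"
          using t(1) by (simp add: f_def y(2) h_def g(3))
        with y(1) show "f z \<in> interior V" by simp
      qed
    qed
    moreover have "(1 - \<epsilon>) * (measure lebesgue U / \<bar>det M\<bar>)
        \<le> real (card S) * (measure lebesgue U / measure lebesgue V)"
    proof -
      have "(1 - \<epsilon>) * (measure lebesgue V / \<bar>det M\<bar>)
          \<le> (1 - \<epsilon> / 2) * (1 / (1 + t)) ^ ?n * (measure lebesgue V / \<bar>det M\<bar>)"
        using const by (intro mult_right_mono) auto
      also have "\<dots> \<le> real (card S)"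
        using S(4) by (simp only: mh mult.assoc)
      finally have "(1 - \<epsilon>) * (measure lebesgue V / \<bar>det M\<bar>) * (measure lebesgue U / measure lebesgue V)
          \<le> real (card S) * (measure lebesgue U / measure lebesgue V)"
        by (intro mult_right_mono) auto
      then show ?thesis
        using Vpos by simp
    qed
    ultimately show "ereal ((1 - \<epsilon>) * (measure lebesgue U / \<bar>det M\<bar>)) \<le> wiener_const U V"
      by (meson ereal_less_eq(3) order_trans)
  qed
qed

theorem theorem3:
  fixes U H :: "(real ^ 'n) set"
  assumes "symmetric_convex_body U"
    and "H = (\<lambda>x. (1 / 2) *\<^sub>R x) ` U"
  shows "(\<forall>V L. symmetric_convex_body V \<longrightarrow> full_rank_lattice L \<longrightarrow> lattice_packing H L \<longrightarrow>
            wiener_const U V \<ge>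
              ereal (real (card (L \<inter> interior V)) * measure lebesgue U / measure lebesgue V)) \<and>
         (\<forall>\<epsilon>::real. \<epsilon> > 0 \<longrightarrow> (\<exists>T::real. T > 0 \<and>
            (\<forall>V. symmetric_convex_body V \<and> measure lebesgue V \<ge> T \<longrightarrow>
               wiener_const U V \<ge>
                 ereal (2 ^ CARD('n)) * lattice_packing_density H * ereal (1 - \<epsilon>))))"
proof (intro conjI allI impI)
  fix V L :: "(real^'n) set"
  assume "symmetric_convex_body V" "full_rank_lattice L" "lattice_packing H L"
  then show "wiener_const U V \<ge> ereal (real (card (L \<inter> interior V)) * measure lebesgue U / measure lebesgue V)"
    using wiener_const_ge_packing_lattice[OF assms(1)] assms(2) by blast
next
  fix \<epsilon> :: real
  assume eps: "\<epsilon> > 0"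
  note U = assms(1) and H = assms(2)
  let ?n = "CARD('n)"
  obtain M0 :: "real^'n^'n" where M0: "det M0 \<noteq> 0" "lattice_packing H (lattice_of M0)"
    using exists_packing_lattice[OF U] H by blast
  have "lattice_packing_density H \<le> ereal 1"
    unfolding lattice_packing_density_def
    using packing_density_le_1[OF U] H by (intro SUP_least) auto
  moreover have "ereal (packing_density H M0) \<le> lattice_packing_density H"
    unfolding lattice_packing_density_def using M0 by (intro SUP_upper) auto
  ultimately obtain d where d: "lattice_packing_density H = ereal d"
    by (cases "lattice_packing_density H") auto
  have rhs: "ereal (2 ^ ?n) * lattice_packing_density H * ereal (1 - \<epsilon>) = ereal (2 ^ ?n * d * (1 - \<epsilon>))"
    by (simp add: d)
  have "ereal (packing_density H M0) \<le> ereal d"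
    using \<open>ereal (packing_density H M0) \<le> lattice_packing_density H\<close> d by simp
  moreover have "packing_density H M0 \<ge> 0"
    by (simp add: packing_density_def)
  ultimately have d0: "d \<ge> 0"
    by simp
  show "\<exists>T::real. T > 0 \<and> (\<forall>V. symmetric_convex_body V \<and> measure lebesgue V \<ge> T \<longrightarrow>
      wiener_const U V \<ge> ereal (2 ^ ?n) * lattice_packing_density H * ereal (1 - \<epsilon>))"
  proof (cases "d = 0 \<or> \<epsilon> \<ge> 1")
    case True
    \<comment> \<open>The claimed bound is not positive, and the first part bounds the constant below by \<open>0\<close>.\<close>
    then have neg: "2 ^ ?n * d * (1 - \<epsilon>) \<le> 0"
      using d0 by (auto intro: mult_nonneg_nonpos)
    have "ereal (2 ^ ?n * d * (1 - \<epsilon>)) \<le> wiener_const U V" if V: "symmetric_convex_body V" for V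
    proof -
      have "full_rank_lattice (lattice_of M0)"
        using M0(1) by (auto simp: full_rank_lattice_def)
      then have "ereal (real (card (lattice_of M0 \<inter> interior V)) * measure lebesgue U / measure lebesgue V) \<le> wiener_const U V"
        using wiener_const_ge_packing_lattice[OF U V] M0(2) H by blast
      moreover have "ereal (2 ^ ?n * d * (1 - \<epsilon>))
          \<le> ereal (real (card (lattice_of M0 \<inter> interior V)) * measure lebesgue U / measure lebesgue V)"
        unfolding ereal_less_eq by (rule order_trans[OF neg]) simp
      ultimately show ?thesis
        by (rule order_trans[rotated])
    qed
    then show ?thesis
      unfolding rhs by (intro exI[of _ 1]) auto
  next
    case False
    then have dpos: "d > 0" and eps1: "\<epsilon> < 1"
      using d0 by auto
    have "ereal ((1 - \<epsilon> / 2) * d) < lattice_packing_density H"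
      using dpos eps by (simp add: d)
    then obtain M where M: "det M \<noteq> 0" "lattice_packing H (lattice_of M)"
      and dense: "(1 - \<epsilon> / 2) * d < packing_density H M"
      unfolding lattice_packing_density_def less_SUP_iff by auto
    have avoid: "M *v z \<notin> interior U" if "z \<in> integer_points" "z \<noteq> 0" for z
      using M(2) that H lattice_packing_half_iff[OF inj_matrix_of_det[OF M(1)]] by blast
    obtain T where T: "T > 0" "\<And>V. symmetric_convex_body V \<Longrightarrow> measure lebesgue V \<ge> T \<Longrightarrow>
        wiener_const U V \<ge> ereal ((1 - \<epsilon> / 2) * (measure lebesgue U / \<bar>det M\<bar>))"
      by (rule wiener_const_ge_density_large_volume[OF U M(1) avoid, of "\<epsilon> / 2"]) (use eps eps1 in auto)
    have "1 - \<epsilon> \<le> (1 - \<epsilon> / 2) * (1 - \<epsilon> / 2)"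
      by (simp add: algebra_simps)
    then have "2 ^ ?n * d * (1 - \<epsilon>) \<le> 2 ^ ?n * d * ((1 - \<epsilon> / 2) * (1 - \<epsilon> / 2))"
      using d0 by (intro mult_left_mono) auto
    also have "\<dots> = (1 - \<epsilon> / 2) * (2 ^ ?n * ((1 - \<epsilon> / 2) * d))"
      by (simp only: mult_ac)
    also have "\<dots> \<le> (1 - \<epsilon> / 2) * (2 ^ ?n * packing_density H M)"
      using dense eps1 by (intro mult_left_mono) auto
    also have "2 ^ ?n * packing_density H M = measure lebesgue U / \<bar>det M\<bar>"
      unfolding H by (rule packing_density_half)
    finally have "ereal (2 ^ ?n * d * (1 - \<epsilon>)) \<le> ereal ((1 - \<epsilon> / 2) * (measure lebesgue U / \<bar>det M\<bar>))"
      by simp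
    then show ?thesis
      unfolding rhs using T by (meson order_trans)
  qed
qed

end
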